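(* Let $M_j=(A_j,B_j;C_j,D_j)$, $j=1,2$, be real matrices with $A_jD_j-B_jC_j=1$ and $B_j\neq 0$. Let $\{V^{M_1,M_2}_m\}_{m\in\mathbb{Z}}$ be an orthogonal MRA associated with the LCST, with scaling function $\phi$, let $W^{M_1,M_2}_0$ be the orthogonal complement of $V^{M_1,M_2}_0$ in $V^{M_1,M_2}_1$, and let $\{c_n\}_{n\in\mathbb{Z}}\in\ell^2(\mathbb{Z})$ be the coefficients with $\phi_{M_1,M_2,0,0}=\sum_{n\in\mathbb{Z}}c_n\phi_{M_1,M_2,1,n}$. Let $\{d_n\}_{n\in\mathbb{Z}}\in\ell^2(\mathbb{Z})$ and $$\psi(t)=\sum_{n\in\mathbb{Z}}d_n\sqrt{2}\,\phi(2t-n)\,e^{\frac{i}{2}\left\{\frac{n^2A_1}{4B_1}+(3t^2-4tn+n^2)\frac{A_2}{B_2}+\frac{2(t+n)}{B_1}\right\}}.$$ Then $\{\psi_{M_1,M_2,0,n}\}_{n\in\mathbb{Z}}$ is an orthonormal basis of $W^{M_1,M_2}_0$ if and only if $$U\left(\frac{B_2u}{B_1}\right)U^{\star}\left(\frac{B_2u}{B_1}\right)=I\quad\text{for a.e. }u\in\mathbb{R},$$ where $I$ is the $2\times2$ identity matrix, $U^\star$ is the conjugate transpose of $U$, and $$U\left(\frac{B_2u}{B_1}\right)=\begin{bmatrix}\Lambda\left(\frac{B_2u}{B_1}\right)&\Lambda\left(\frac{B_2}{B_1}(u+\pi|B_1|)\right)\\[2pt]\Gamma\left(\frac{B_2u}{B_1}\right)&\Gamma\left(\frac{B_2}{B_1}(u+\pi|B_1|)\right)\end{bmatrix},$$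 $$\Lambda(u)=\frac{\sqrt2}{2}\sum_{n\in\mathbb{Z}}c_n e^{\frac{i}{2}\left(\frac{n^2A_1}{4B_1}+\frac{4n}{B_1}-\frac{2nu}{B_2}\right)},\qquad \Gamma(u)=\frac{\sqrt2}{2}\sum_{n\in\mathbb{Z}}d_n e^{\frac{i}{2}\left(\frac{n^2A_1}{4B_1}+\frac{4n}{B_1}-\frac{2nu}{B_2}\right)}.$$
   Context: $M=(A,B;C,D)$ denotes the $2\times2$ matrix with rows $(A,B)$ and $(C,D)$. Series of $L^2$ functions converge in the $L^2$ sense (on $\mathbb{R}$, respectively over a period for $\Lambda,\Gamma$). For $\theta\in L^2(\mathbb{R})$ and $m,n\in\mathbb{Z}$ put $$\theta_{M_1,M_2,m,n}(t)=2^{\frac m2}\theta(2^mt-n)\,e^{-\frac{i}{2}\left\{\left(t^2-\left(\frac{n}{2^m}\right)^2\right)\frac{A_1}{B_1}-(2^mt-n)^2\frac{A_2}{B_2}-\frac{2(2^mt+n)}{B_1}\right\}};$$ in particular $\theta_{M_1,M_2,0,n}(t)=\theta(t-n)e^{-\frac{i}{2}\{(t^2-n^2)\frac{A_1}{B_1}-(t-n)^2\frac{A_2}{B_2}-\frac{2(t+n)}{B_1}\}}$. This notation is applied with $\theta=\phi$ and $\theta=\psi$. An orthogonal MRA associated with the LCST (linear canonical Stockwell transform) is a sequence of closed subspaces $V^{M_1,M_2}_m\subset L^2(\mathbb{R})$, $m\in\mathbb{Z}$, such that: (1) $V^{M_1,M_2}_m\subset V^{M_1,M_2}_{m+1}$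 for all $m$; (2) $f(t)\in V^{M_1,M_2}_m\iff f(2t)e^{\frac{iA_1}{2B_1}\{(2t)^2-t^2\}}\in V^{M_1,M_2}_{m+1}$ for all $m$; (3) $\bigcap_m V^{M_1,M_2}_m=\{0\}$ and $\overline{\bigcup_m V^{M_1,M_2}_m}=L^2(\mathbb{R})$; (4) there is $\phi\in L^2(\mathbb{R})$ (the scaling function) such that $\{\phi_{M_1,M_2,0,n}\}_{n\in\mathbb{Z}}$ is an orthonormal basis of $V^{M_1,M_2}_0$. For such an MRA, $\{\phi_{M_1,M_2,1,n}\}_{n\in\mathbb{Z}}$ is an orthonormal basis of $V^{M_1,M_2}_1$, so the coefficients $c_n$ exist and are unique. *)

theory Defs
  imports "HOL-Analysis.Analysis" "HOL-Library.Function_Algebras"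
begin

text \<open>
  Elements of \<open>L\<^sup>2(M)\<close> are represented by measurable, square-integrable functions; they are not
  quotiented by almost-everywhere equality.  Sets of functions that stand for closed subspaces are
  closed in the \<open>L\<^sup>2\<close> seminorm, hence saturated with respect to almost-everywhere equality.
\<close>

definition l2_space :: "'a measure \<Rightarrow> ('a \<Rightarrow> complex) set" where
  "l2_space M = {f. f \<in> borel_measurable M \<and> integrable M (\<lambda>t. (cmod (f t))\<^sup>2)}"

definition l2_inner :: "'a measure \<Rightarrow> ('a \<Rightarrow> complex) \<Rightarrow> ('a \<Rightarrow> complex) \<Rightarrow> complex" where
  "l2_inner M f g = (LINT t|M. f t * cnj (g t))"

definition l2_norm :: "'a measure \<Rightarrow> ('a \<Rightarrow> complex) \<Rightarrow> real" where
  "l2_norm M f = sqrt (LINT t|M. (cmod (f t))\<^sup>2)"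

definition l2_closure :: "'a measure \<Rightarrow> ('a \<Rightarrow> complex) set \<Rightarrow> ('a \<Rightarrow> complex) set" where
  "l2_closure M S =
     {f \<in> l2_space M. \<forall>\<epsilon>>0. \<exists>g\<in>S \<inter> l2_space M. l2_norm M (\<lambda>t. f t - g t) < \<epsilon>}"

definition l2_has_sum ::
  "'a measure \<Rightarrow> ('i \<Rightarrow> 'a \<Rightarrow> complex) \<Rightarrow> ('a \<Rightarrow> complex) \<Rightarrow> bool" where
  "l2_has_sum M g f \<longleftrightarrow>
     (\<forall>n. g n \<in> l2_space M) \<and> f \<in> l2_space M \<and>
     ((\<lambda>F. l2_norm M (\<lambda>t. f t - (\<Sum>n\<in>F. g n t))) \<longlongrightarrow> 0) (finite_subsets_at_top UNIV)"

definition is_l2_seq :: "('i \<Rightarrow> complex) \<Rightarrow> bool" where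
  "is_l2_seq c \<longleftrightarrow> (\<lambda>n. (cmod (c n))\<^sup>2) summable_on UNIV"

text \<open>Complex-valued functions as a complex vector space; provides \<open>cfun.subspace\<close> and \<open>cfun.span\<close>.\<close>

interpretation cfun: vector_space "\<lambda>(c::complex) (f::'a \<Rightarrow> complex) t. c * f t"
  by unfold_locales (auto simp: fun_eq_iff algebra_simps)

definition l2_closed_subspace :: "'a measure \<Rightarrow> ('a \<Rightarrow> complex) set \<Rightarrow> bool" where
  "l2_closed_subspace M V \<longleftrightarrow> V \<subseteq> l2_space M \<and> cfun.subspace V \<and> l2_closure M V = V"

definition l2_orthonormal_basis ::
  "'a measure \<Rightarrow> ('a \<Rightarrow> complex) set \<Rightarrow> ('i \<Rightarrow> 'a \<Rightarrow> complex) \<Rightarrow> bool" where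
  "l2_orthonormal_basis M V e \<longleftrightarrow>
     (\<forall>n. e n \<in> V) \<and>
     (\<forall>m n. l2_inner M (e m) (e n) = (if m = n then 1 else 0)) \<and>
     V \<subseteq> l2_closure M (cfun.span (range e))"

definition l2_orth_complement ::
  "'a measure \<Rightarrow> ('a \<Rightarrow> complex) set \<Rightarrow> ('a \<Rightarrow> complex) set \<Rightarrow> ('a \<Rightarrow> complex) set" where
  "l2_orth_complement M V V' = {f \<in> V'. \<forall>g\<in>V. l2_inner M f g = 0}"

text \<open>
  For \<open>M = (A, B; C, D)\<close> we have \<open>A = M $ 1 $ 1\<close> and \<open>B = M $ 1 $ 2\<close>; only these two entries
  enter the formulas below.
\<close>

definition lcst_family ::
  "real^2^2 \<Rightarrow> real^2^2 \<Rightarrow> (real \<Rightarrow> complex) \<Rightarrow> int \<Rightarrow> int \<Rightarrow> real \<Rightarrow> complex" where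
  "lcst_family M1 M2 \<theta> m n t =
     (let A1 = M1 $ 1 $ 1; B1 = M1 $ 1 $ 2; A2 = M2 $ 1 $ 1; B2 = M2 $ 1 $ 2 in
      complex_of_real (2 powr (m / 2)) * \<theta> (2 powi m * t - n) *
      exp (- (\<i> / 2) * complex_of_real
        ((t\<^sup>2 - (n / 2 powi m)\<^sup>2) * (A1 / B1) - (2 powi m * t - n)\<^sup>2 * (A2 / B2)
          - 2 * (2 powi m * t + n) / B1)))"

definition lcst_scaling_function ::
  "real^2^2 \<Rightarrow> real^2^2 \<Rightarrow> (int \<Rightarrow> (real \<Rightarrow> complex) set) \<Rightarrow> (real \<Rightarrow> complex) \<Rightarrow> bool" where
  "lcst_scaling_function M1 M2 V \<phi> \<longleftrightarrow>
     \<phi> \<in> l2_space lborel \<and> l2_orthonormal_basis lborel (V 0) (lcst_family M1 M2 \<phi> 0)"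

definition lcst_orthogonal_MRA ::
  "real^2^2 \<Rightarrow> real^2^2 \<Rightarrow> (int \<Rightarrow> (real \<Rightarrow> complex) set) \<Rightarrow> bool" where
  "lcst_orthogonal_MRA M1 M2 V \<longleftrightarrow>
     (let A1 = M1 $ 1 $ 1; B1 = M1 $ 1 $ 2 in
      (\<forall>m. l2_closed_subspace lborel (V m)) \<and>
      (\<forall>m. V m \<subseteq> V (m + 1)) \<and>
      (\<forall>m. \<forall>f\<in>l2_space lborel. f \<in> V m \<longleftrightarrow>
         (\<lambda>t. f (2 * t) * exp (\<i> * complex_of_real (A1 / (2 * B1) * ((2 * t)\<^sup>2 - t\<^sup>2)))) \<in> V (m + 1)) \<and>
      (\<Inter>m. V m) = {f \<in> l2_space lborel. AE t in lborel. f t = 0} \<and>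
      l2_closure lborel (\<Union>m. V m) = l2_space lborel \<and>
      (\<exists>\<phi>. lcst_scaling_function M1 M2 V \<phi>))"

definition lcst_wavelet_series ::
  "real^2^2 \<Rightarrow> real^2^2 \<Rightarrow> (real \<Rightarrow> complex) \<Rightarrow> (int \<Rightarrow> complex) \<Rightarrow> (real \<Rightarrow> complex) \<Rightarrow> bool" where
  "lcst_wavelet_series M1 M2 \<phi> d \<psi> \<longleftrightarrow>
     (let A1 = M1 $ 1 $ 1; B1 = M1 $ 1 $ 2; A2 = M2 $ 1 $ 1; B2 = M2 $ 1 $ 2 in
      l2_has_sum lborel
        (\<lambda>(n::int) t. d n * complex_of_real (sqrt 2) * \<phi> (2 * t - n) *
           exp ((\<i> / 2) * complex_of_real
             (n\<^sup>2 * A1 / (4 * B1) + (3 * t\<^sup>2 - 4 * t * n + n\<^sup>2) * (A2 / B2) + 2 * (t + n) / B1)))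
        \<psi>)"

text \<open>
  \<open>F\<close> is a representative of the \<open>2\<pi>|B\<^sub>2|\<close>-periodic function defined by the trigonometric series with
  coefficients \<open>a\<close>.  Demanding \<open>L\<^sup>2\<close> convergence over every interval of one period length makes \<open>F\<close>
  periodic almost everywhere and determines it up to a null set on all of the real line.
\<close>

definition lcst_symbol ::
  "real^2^2 \<Rightarrow> real^2^2 \<Rightarrow> (int \<Rightarrow> complex) \<Rightarrow> (real \<Rightarrow> complex) \<Rightarrow> bool" where
  "lcst_symbol M1 M2 a F \<longleftrightarrow>
     (let A1 = M1 $ 1 $ 1; B1 = M1 $ 1 $ 2; B2 = M2 $ 1 $ 2 in
      \<forall>p. l2_has_sum (restrict_space lborel {p..p + 2 * pi * \<bar>B2\<bar>})
        (\<lambda>(n::int) u. complex_of_real (sqrt 2 / 2) * a n *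
           exp ((\<i> / 2) * complex_of_real (n\<^sup>2 * A1 / (4 * B1) + 4 * n / B1 - 2 * n * u / B2)))
        F)"

text \<open>The matrix \<open>U(B\<^sub>2 u / B\<^sub>1)\<close>, as a function of \<open>u\<close>.\<close>

definition lcst_U ::
  "real^2^2 \<Rightarrow> real^2^2 \<Rightarrow> (real \<Rightarrow> complex) \<Rightarrow> (real \<Rightarrow> complex) \<Rightarrow> real \<Rightarrow> complex^2^2" where
  "lcst_U M1 M2 \<Lambda> \<Gamma> u =
     (let B1 = M1 $ 1 $ 2; B2 = M2 $ 1 $ 2 in
      vector [vector [\<Lambda> (B2 * u / B1), \<Lambda> (B2 / B1 * (u + pi * \<bar>B1\<bar>))],
              vector [\<Gamma> (B2 * u / B1), \<Gamma> (B2 / B1 * (u + pi * \<bar>B1\<bar>))]])"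

definition conj_transpose :: "complex^'n^'m \<Rightarrow> complex^'m^'n" where
  "conj_transpose A = (\<chi> i j. cnj (A $ j $ i))"

end

theory Submission
  imports Defs
begin

text \<open>
  Removing the chirps reduces the statement to the classical theorem on two-channel filter banks.
  Put \<open>a = A1/B1\<close> and \<open>\<Phi>(t) = e(t\<^sup>2 A2/(2 B2) + t/B1) \<phi>(t)\<close>, where \<open>e(s)\<close> is \<open>cis s\<close>,
  and \<open>\<Psi>\<close> likewise from \<open>\<psi>\<close>. Up to constants of modulus 1, which change neither orthonormality nor
  spans, the members of the LCST family are \<open>F k t = e(-a t\<^sup>2/2) \<Phi>(t - k)\<close> at level 0,
  \<open>G k t = e(-a t\<^sup>2/2) \<Psi>(t - k)\<close> for the wavelet, and \<open>E n t = e(-a t\<^sup>2/2) \<surd>2 \<Phi>(2t - n)\<close>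
  at level 1. The constants move into the coefficients: with \<open>x n\<close> and \<open>y n\<close> denoting \<open>c n\<close> and
  \<open>d n\<close> times \<open>cis (n\<^sup>2 a/8 + 2n/B1)\<close>, translating the two given series yields
  \<open>F k = \<Sum> x (n - 2k) E n\<close> and \<open>G k = \<Sum> y (n - 2k) E n\<close>, and \<open>\<Lambda>\<close>, \<open>\<Gamma>\<close> are the
  trigonometric series with coefficients \<open>x n/\<surd>2\<close>, \<open>y n/\<surd>2\<close>. The scaling property of the MRA
  carries the basis \<open>F\<close> of \<open>V 0\<close> to the basis \<open>E\<close> of \<open>V 1\<close> (lemma \<open>chirp_dilate_basis\<close>).

  By Parseval, \<open>\<langle>F j, G k\<rangle>\<close> is a Fourier coefficient, with index \<open>2(j - k)\<close>, of \<open>\<Lambda> cnj \<Gamma>\<close>.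
  Exponentials of even index have half the period \<open>H = \<pi>|B2|\<close>, so only the folded function
  \<open>\<Lambda>(v) cnj \<Gamma>(v) + \<Lambda>(v + H) cnj \<Gamma>(v + H)\<close> matters, and it is an off-diagonal entry of
  \<open>U U\<^sup>\<star>\<close>; the diagonal entries arise in the same way from \<open>\<langle>F j, F k\<rangle>\<close> and \<open>\<langle>G j, G k\<rangle>\<close>.
  An integrable function is determined by its Fourier coefficients (lemma \<open>Fourier_uniqueness\<close>,
  from the Stone-Weierstrass theorem), so \<open>U U\<^sup>\<star> = I\<close> almost everywhere holds exactly if \<open>F\<close>
  and \<open>G\<close> together form an orthonormal family (lemma \<open>inner_iff_fold_product\<close>). This gives one
  direction.

  For the other direction the completeness of \<open>G\<close> in the complement has to be shown. For a square
  matrix \<open>U U\<^sup>\<star> = I\<close> implies \<open>U\<^sup>\<star> U = I\<close>; integrating the entries of the latter gives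
  \<open>\<Sum>(|x n|\<^sup>2 + |y n|\<^sup>2) = 2\<close> and \<open>\<Sum>(-1)\<^sup>n(|x n|\<^sup>2 + |y n|\<^sup>2) = 0\<close>, so the sum over the
  even indices and the sum over the odd ones are both 1. The numbers \<open>|x (j - 2k)|\<^sup>2\<close> and
  \<open>|y (j - 2k)|\<^sup>2\<close> are the squared coefficients of \<open>E j\<close> with respect to \<open>F\<close> and \<open>G\<close>; they add
  up to \<open>1 = \<parallel>E j\<parallel>\<^sup>2\<close>, so \<open>E j\<close> lies in the closed span of \<open>F\<close> and \<open>G\<close>, and hence so does
  \<open>V 1\<close> (theorem \<open>wavelet_basis_iff_symbol\<close>).
\<close>

section \<open>The Hilbert space structure of square-integrable functions\<close>

lemma l2_space_zero [simp]: "(\<lambda>t. 0) \<in> l2_space M"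
  by (simp add: l2_space_def)

lemma l2_space_scale: "f \<in> l2_space M \<Longrightarrow> (\<lambda>t. c * f t) \<in> l2_space M"
  by (auto simp: l2_space_def norm_mult power_mult_distrib)

lemma norm_add_sq_le: "(cmod (x + y))\<^sup>2 \<le> 2 * (cmod x)\<^sup>2 + 2 * (cmod y)\<^sup>2"
proof -
  have "(cmod (x + y))\<^sup>2 \<le> (cmod x + cmod y)\<^sup>2"
    by (simp add: norm_triangle_ineq power_mono)
  also have "\<dots> \<le> 2 * (cmod x)\<^sup>2 + 2 * (cmod y)\<^sup>2"
    using sum_squares_bound[of "cmod x" "cmod y"] by (simp add: power2_sum)
  finally show ?thesis .
qed

lemma l2_space_add:
  assumes "f \<in> l2_space M" "g \<in> l2_space M"
  shows "(\<lambda>t. f t + g t) \<in> l2_space M"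
proof -
  have [measurable]: "f \<in> borel_measurable M" "g \<in> borel_measurable M"
    using assms by (auto simp: l2_space_def)
  have "integrable M (\<lambda>t. (cmod (f t + g t))\<^sup>2)"
  proof (rule Bochner_Integration.integrable_bound)
    show "integrable M (\<lambda>t. 2 * (cmod (f t))\<^sup>2 + 2 * (cmod (g t))\<^sup>2)"
      using assms by (auto simp: l2_space_def)
  qed (auto simp: norm_add_sq_le)
  then show ?thesis
    by (simp add: l2_space_def)
qed

lemma l2_space_diff:
  assumes "f \<in> l2_space M" "g \<in> l2_space M"
  shows "(\<lambda>t. f t - g t) \<in> l2_space M"
  using l2_space_add[OF assms(1) l2_space_scale[OF assms(2), of "-1"]] by simp

lemma l2_space_sum:
  assumes "\<And>n. n \<in> F \<Longrightarrow> g n \<in> l2_space M"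
  shows "(\<lambda>t. \<Sum>n\<in>F. g n t) \<in> l2_space M"
  using assms by (induction F rule: infinite_finite_induct) (auto intro: l2_space_add)

lemma integrable_l2_product:
  assumes "f \<in> l2_space M" "g \<in> l2_space M"
  shows "integrable M (\<lambda>t. f t * cnj (g t))"
proof (rule Bochner_Integration.integrable_bound)
  have [measurable]: "f \<in> borel_measurable M" "g \<in> borel_measurable M"
    using assms by (auto simp: l2_space_def)
  show "integrable M (\<lambda>t. (cmod (f t))\<^sup>2 + (cmod (g t))\<^sup>2)"
    using assms by (auto simp: l2_space_def)
  have "(\<lambda>t. cnj (g t)) \<in> borel_measurable M"
    by (rule borel_measurable_continuous_on[of cnj]) (auto intro: continuous_intros)
  then show "(\<lambda>t. f t * cnj (g t)) \<in> borel_measurable M" by measurable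
  have "cmod (f t) * cmod (g t) \<le> (cmod (f t))\<^sup>2 + (cmod (g t))\<^sup>2" for t
    using sum_squares_bound[of "cmod (f t)" "cmod (g t)"]
      zero_le_power2[of "cmod (f t)"] zero_le_power2[of "cmod (g t)"] by linarith
  then show "AE t in M. norm (f t * cnj (g t)) \<le> norm ((cmod (f t))\<^sup>2 + (cmod (g t))\<^sup>2)"
    by (auto simp: norm_mult)
qed

lemma l2_inner_add_left:
  "\<lbrakk>f \<in> l2_space M; g \<in> l2_space M; h \<in> l2_space M\<rbrakk> \<Longrightarrow>
    l2_inner M (\<lambda>t. f t + g t) h = l2_inner M f h + l2_inner M g h"
  unfolding l2_inner_def
  by (subst Bochner_Integration.integral_add[symmetric])
     (auto intro: integrable_l2_product simp: algebra_simps)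

lemma l2_inner_scale_left: "l2_inner M (\<lambda>t. c * f t) h = c * l2_inner M f h"
  by (simp add: l2_inner_def mult.assoc)

lemma l2_inner_commute: "l2_inner M f g = cnj (l2_inner M g f)"
  by (simp add: l2_inner_def mult.commute flip: Bochner_Integration.integral_cnj)

lemma l2_inner_zero_left [simp]: "l2_inner M (\<lambda>t. 0) h = 0"
  by (simp add: l2_inner_def)

lemma l2_inner_diff_left:
  "\<lbrakk>f \<in> l2_space M; g \<in> l2_space M; h \<in> l2_space M\<rbrakk> \<Longrightarrow>
    l2_inner M (\<lambda>t. f t - g t) h = l2_inner M f h - l2_inner M g h"
  using l2_inner_add_left[of f M "\<lambda>t. -1 * g t" h] l2_space_scale[of g M "-1"]
    l2_inner_scale_left[of M "-1" g h] by simp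

lemma l2_inner_sum_left:
  assumes "\<And>n. n \<in> F \<Longrightarrow> g n \<in> l2_space M" "h \<in> l2_space M"
  shows "l2_inner M (\<lambda>t. \<Sum>n\<in>F. g n t) h = (\<Sum>n\<in>F. l2_inner M (g n) h)"
  using assms
  by (induction F rule: infinite_finite_induct) (auto simp: l2_inner_add_left l2_space_sum)

lemma l2_inner_scale_right: "l2_inner M h (\<lambda>t. c * f t) = cnj c * l2_inner M h f"
  by (subst (1 2) l2_inner_commute) (simp add: l2_inner_scale_left)

lemma l2_inner_add_right:
  "\<lbrakk>f \<in> l2_space M; g \<in> l2_space M; h \<in> l2_space M\<rbrakk> \<Longrightarrow>
    l2_inner M h (\<lambda>t. f t + g t) = l2_inner M h f + l2_inner M h g"
  by (subst (1 2 3) l2_inner_commute) (simp add: l2_inner_add_left)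

lemma l2_inner_self: "l2_inner M f f = complex_of_real ((l2_norm M f)\<^sup>2)"
proof -
  have "f t * cnj (f t) = complex_of_real ((cmod (f t))\<^sup>2)" for t
    by (rule complex_norm_square[symmetric])
  then show ?thesis
    by (simp add: l2_inner_def l2_norm_def del: of_real_power)
qed

lemma l2_norm_nonneg [simp]: "0 \<le> l2_norm M f"
  by (simp add: l2_norm_def)

lemma l2_norm_scale: "l2_norm M (\<lambda>t. c * f t) = cmod c * l2_norm M f"
  by (simp add: l2_norm_def norm_mult power_mult_distrib real_sqrt_mult)

lemma l2_norm_add_sq:
  assumes "f \<in> l2_space M" "g \<in> l2_space M"
  shows "(l2_norm M (\<lambda>t. f t + g t))\<^sup>2
    = (l2_norm M f)\<^sup>2 + (l2_norm M g)\<^sup>2 + 2 * Re (l2_inner M f g)"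
proof -
  have "complex_of_real ((l2_norm M (\<lambda>t. f t + g t))\<^sup>2)
    = l2_inner M (\<lambda>t. f t + g t) (\<lambda>t. f t + g t)"
    by (rule l2_inner_self[symmetric])
  also have "\<dots> = l2_inner M f f + l2_inner M g g + (l2_inner M f g + cnj (l2_inner M f g))"
    using assms l2_inner_commute[of M g f]
    by (simp add: l2_inner_add_left l2_inner_add_right l2_space_add)
  also have "\<dots> = complex_of_real ((l2_norm M f)\<^sup>2 + (l2_norm M g)\<^sup>2 + 2 * Re (l2_inner M f g))"
    by (simp add: l2_inner_self complex_add_cnj)
  finally show ?thesis
    using of_real_eq_iff by blast
qed

text \<open>
  Expanding \<open>\<parallel>f - s z g\<parallel>\<^sup>2 \<ge> 0\<close>, where \<open>z\<close> is the inner product, gives a quadratic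
  inequality in the real number \<open>s\<close>. Elements of norm 0 need not vanish here, so the case
  \<open>\<parallel>g\<parallel> = 0\<close> is argued from the same inequality, with \<open>s\<close> large.
\<close>

lemma l2_Cauchy_Schwarz:
  assumes "f \<in> l2_space M" "g \<in> l2_space M"
  shows "cmod (l2_inner M f g) \<le> l2_norm M f * l2_norm M g"
proof -
  define z where "z = l2_inner M f g"
  have *: "0 \<le> (l2_norm M f)\<^sup>2 + s\<^sup>2 * (cmod z)\<^sup>2 * (l2_norm M g)\<^sup>2 - 2 * s * (cmod z)\<^sup>2" for s
      :: real
  proof -
    have "l2_inner M f (\<lambda>t. - (complex_of_real s * z) * g t) = cnj (- (complex_of_real s * z)) * z"
      unfolding z_def by (rule l2_inner_scale_right)
    also have "\<dots> = complex_of_real (- s) * (z * cnj z)"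
      by simp
    also have "\<dots> = complex_of_real (- s * (cmod z)\<^sup>2)"
      by (simp only: complex_norm_square[symmetric] of_real_mult)
    finally have "Re (l2_inner M f (\<lambda>t. - (complex_of_real s * z) * g t)) = - s * (cmod z)\<^sup>2"
      by (simp only: Re_complex_of_real)
    moreover have "0 \<le> (l2_norm M (\<lambda>t. f t + (- (complex_of_real s * z)) * g t))\<^sup>2"
      by (rule zero_le_power2)
    moreover have "(l2_norm M (\<lambda>t. (- (complex_of_real s * z)) * g t))\<^sup>2
        = s\<^sup>2 * (cmod z)\<^sup>2 * (l2_norm M g)\<^sup>2"
      unfolding l2_norm_scale by (simp add: power_mult_distrib norm_mult)
    ultimately show ?thesis
      using l2_norm_add_sq[OF assms(1) l2_space_scale[OF assms(2), of "- (complex_of_real s * z)"]]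
      by linarith
  qed
  show ?thesis
  proof (cases "z = 0 \<or> l2_norm M g = 0")
    case True
    have False if "z \<noteq> 0" "l2_norm M g = 0"
    proof -
      have "0 \<le> (l2_norm M f)\<^sup>2 - 2 * ((l2_norm M f)\<^sup>2 + 1)"
        using *[of "((l2_norm M f)\<^sup>2 + 1) / (cmod z)\<^sup>2"] that by simp
      then have "(l2_norm M f)\<^sup>2 + 2 \<le> 0"
        by (simp add: algebra_simps)
      then show False
        by (smt (verit) zero_le_power2)
    qed
    then have "z = 0"
      using True by blast
    then show ?thesis
      by (simp add: z_def[symmetric])
  next
    case False
    define b where "b = (l2_norm M g)\<^sup>2"
    have b: "b > 0" using False by (simp add: b_def)
    have "(1 / b)\<^sup>2 * (cmod z)\<^sup>2 * b = (cmod z)\<^sup>2 / b"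
      using b by (simp add: power2_eq_square)
    then have "0 \<le> (l2_norm M f)\<^sup>2 - (cmod z)\<^sup>2 / b"
      using *[of "1 / b"] by (simp add: b_def[symmetric])
    then have "(cmod z)\<^sup>2 \<le> (l2_norm M f)\<^sup>2 * b"
      using b by (simp add: field_simps)
    then have "(cmod z)\<^sup>2 \<le> (l2_norm M f * l2_norm M g)\<^sup>2"
      by (simp add: power_mult_distrib b_def)
    then show ?thesis
      unfolding z_def by (rule power2_le_imp_le) simp
  qed
qed

lemma l2_norm_triangle:
  assumes "f \<in> l2_space M" "g \<in> l2_space M"
  shows "l2_norm M (\<lambda>t. f t + g t) \<le> l2_norm M f + l2_norm M g"
proof (rule power2_le_imp_le)
  have "Re (l2_inner M f g) \<le> l2_norm M f * l2_norm M g"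
    using l2_Cauchy_Schwarz[OF assms] complex_Re_le_cmod order_trans by blast
  then show "(l2_norm M (\<lambda>t. f t + g t))\<^sup>2 \<le> (l2_norm M f + l2_norm M g)\<^sup>2"
    using l2_norm_add_sq[OF assms] by (simp add: power2_sum)
qed simp

section \<open>Series, orthonormal families and Parseval\<close>

text \<open>
  The inner product with \<open>h\<close> is continuous by Cauchy-Schwarz, so it may be taken term by term.
\<close>

lemma l2_has_sum_inner:
  assumes "l2_has_sum M g f" "h \<in> l2_space M"
  shows "((\<lambda>n. l2_inner M (g n) h) has_sum l2_inner M f h) UNIV"
proof -
  have f: "f \<in> l2_space M" and g: "\<And>n. g n \<in> l2_space M"
    and lim: "((\<lambda>F. l2_norm M (\<lambda>t. f t - (\<Sum>n\<in>F. g n t))) \<longlongrightarrow> 0) (finite_subsets_at_top UNIV)"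
    using assms by (auto simp: l2_has_sum_def)
  have "((\<lambda>F. l2_inner M f h - (\<Sum>n\<in>F. l2_inner M (g n) h)) \<longlongrightarrow> 0) (finite_subsets_at_top UNIV)"
  proof (rule Lim_null_comparison)
    show "\<forall>\<^sub>F F in finite_subsets_at_top UNIV. norm (l2_inner M f h - (\<Sum>n\<in>F. l2_inner M (g n) h))
            \<le> l2_norm M (\<lambda>t. f t - (\<Sum>n\<in>F. g n t)) * l2_norm M h"
    proof (rule always_eventually, rule allI)
      fix F
      have "l2_inner M f h - (\<Sum>n\<in>F. l2_inner M (g n) h)
          = l2_inner M (\<lambda>t. f t - (\<Sum>n\<in>F. g n t)) h"
        using f g assms(2) by (simp add: l2_inner_diff_left l2_inner_sum_left l2_space_sum)
      then show "norm (l2_inner M f h - (\<Sum>n\<in>F. l2_inner M (g n) h))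
            \<le> l2_norm M (\<lambda>t. f t - (\<Sum>n\<in>F. g n t)) * l2_norm M h"
        using l2_Cauchy_Schwarz[of "\<lambda>t. f t - (\<Sum>n\<in>F. g n t)" M h] f g assms(2)
        by (simp add: l2_space_diff l2_space_sum)
    qed
    show "((\<lambda>F. l2_norm M (\<lambda>t. f t - (\<Sum>n\<in>F. g n t)) * l2_norm M h) \<longlongrightarrow> 0)
        (finite_subsets_at_top UNIV)"
      using tendsto_mult_left_zero[OF lim] .
  qed
  from tendsto_diff[OF tendsto_const[of "l2_inner M f h"] this]
  show ?thesis
    by (simp add: has_sum_def)
qed

lemma l2_coefficient:
  assumes g: "l2_has_sum M (\<lambda>n t. y n * e n t) g" and e: "\<And>n. e n \<in> l2_space M"
    and orth: "\<And>m n. l2_inner M (e m) (e n) = (if m = n then K else 0)"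
  shows "l2_inner M g (e m) = y m * K"
proof -
  have "((\<lambda>n. y n * l2_inner M (e n) (e m)) has_sum l2_inner M g (e m)) UNIV"
    using l2_has_sum_inner[OF g e] by (simp add: l2_inner_scale_left)
  then have "((\<lambda>n. y n * l2_inner M (e n) (e m)) has_sum l2_inner M g (e m)) {m}"
    by (subst has_sum_cong_neutral[where T = UNIV]) (auto simp: orth)
  then show ?thesis
    by (simp add: has_sum_finite_iff orth)
qed

text \<open>
  The constant \<open>K\<close> allows for orthogonal families that are not normalized, such as the
  exponentials on a period of arbitrary length.
\<close>

lemma l2_Parseval:
  assumes f: "l2_has_sum M (\<lambda>n t. x n * e n t) f"
    and g: "l2_has_sum M (\<lambda>n t. y n * e n t) g"
    and e: "\<And>n. e n \<in> l2_space M"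
    and orth: "\<And>m n. l2_inner M (e m) (e n) = (if m = n then K else 0)"
  shows "((\<lambda>n. K * (x n * cnj (y n))) has_sum l2_inner M f g) UNIV"
proof -
  have "l2_inner M g (e m) = y m * K" for m
    using g e orth by (rule l2_coefficient)
  \<comment> \<open>\<open>K\<close> is a squared norm, hence real.\<close>
  moreover have "cnj K = K"
    using l2_inner_commute[of M "e undefined" "e undefined"] by (simp add: orth)
  ultimately have "l2_inner M (e n) g = K * cnj (y n)" for n
    by (subst l2_inner_commute) simp
  moreover have "((\<lambda>n. x n * l2_inner M (e n) g) has_sum l2_inner M f g) UNIV"
    using l2_has_sum_inner[OF f] g by (simp add: l2_inner_scale_left l2_has_sum_def)
  ultimately show ?thesis
    by (simp add: mult.left_commute)
qed

lemma l2_has_sum_reindex: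
  assumes "l2_has_sum M g f" "bij h"
  shows "l2_has_sum M (\<lambda>n. g (h n)) f"
proof -
  have lim: "((\<lambda>F. l2_norm M (\<lambda>t. f t - (\<Sum>n\<in>F. g n t))) \<longlongrightarrow> 0) (finite_subsets_at_top UNIV)"
    using assms by (simp add: l2_has_sum_def)
  have inj: "inj h" using assms bij_is_inj by blast
  have "finite_subsets_at_top UNIV = filtermap ((`) h) (finite_subsets_at_top UNIV)"
    using filtermap_image_finite_subsets_at_top[OF inj] bij_is_surj[OF assms(2)] by simp
  with lim have "((\<lambda>F. l2_norm M (\<lambda>t. f t - (\<Sum>n\<in>h ` F. g n t))) \<longlongrightarrow> 0) (finite_subsets_at_top UNIV)"
    by (simp add: filterlim_filtermap)
  moreover have "(\<Sum>n\<in>h ` F. g n t) = (\<Sum>n\<in>F. g (h n) t)" for F t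
    using inj by (subst sum.reindex) (auto simp: inj_on_def)
  ultimately show ?thesis
    using assms(1) by (simp add: l2_has_sum_def)
qed

text \<open>
  Weighted composition operators that multiply the norm by a constant preserve convergence of
  series. This covers multiplication by functions of modulus 1, translations and dilations.
\<close>

lemma l2_has_sum_transform:
  assumes sum: "l2_has_sum M g f"
    and T: "\<And>f. f \<in> l2_space M \<Longrightarrow> (\<lambda>t. w t * f (\<sigma> t)) \<in> l2_space N"
    and norm: "\<And>f. f \<in> l2_space M \<Longrightarrow> l2_norm N (\<lambda>t. w t * f (\<sigma> t)) = K * l2_norm M f"
  shows "l2_has_sum N (\<lambda>n t. w t * g n (\<sigma> t)) (\<lambda>t. w t * f (\<sigma> t))"
proof -
  have f: "f \<in> l2_space M" and g: "\<And>n. g n \<in> l2_space M"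
    and lim: "((\<lambda>F. l2_norm M (\<lambda>t. f t - (\<Sum>n\<in>F. g n t))) \<longlongrightarrow> 0) (finite_subsets_at_top UNIV)"
    using sum by (auto simp: l2_has_sum_def)
  have "l2_norm N (\<lambda>t. w t * f (\<sigma> t) - (\<Sum>n\<in>F. w t * g n (\<sigma> t)))
      = K * l2_norm M (\<lambda>t. f t - (\<Sum>n\<in>F. g n t))" for F
    using norm[of "\<lambda>t. f t - (\<Sum>n\<in>F. g n t)"] f g
    by (simp add: l2_space_diff l2_space_sum right_diff_distrib sum_distrib_left)
  then show ?thesis
    using f g T tendsto_mult_right_zero[OF lim] by (simp add: l2_has_sum_def)
qed

definition orthonormal :: "'a measure \<Rightarrow> ('i \<Rightarrow> 'a \<Rightarrow> complex) \<Rightarrow> bool" where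
  "orthonormal M e \<longleftrightarrow> (\<forall>n. e n \<in> l2_space M) \<and> (\<forall>m n. l2_inner M (e m) (e n)
      = (if m = n then 1 else 0))"

text \<open>
  The squared distance from \<open>h\<close> to a partial sum of its expansion is \<open>\<parallel>h\<parallel>\<^sup>2\<close> minus the partial sum
  of the squared coefficients, so equality in Bessel's inequality forces convergence.
\<close>

lemma orthonormal_expansion:
  assumes b: "orthonormal M b" and h: "h \<in> l2_space M"
    and sum: "((\<lambda>i. (cmod (l2_inner M h (b i)))\<^sup>2) has_sum (l2_norm M h)\<^sup>2) UNIV"
  shows "l2_has_sum M (\<lambda>i t. l2_inner M h (b i) * b i t) h"
proof -
  define c where "c i = l2_inner M h (b i)" for i
  have bs: "b i \<in> l2_space M" "(\<lambda>t. c i * b i t) \<in> l2_space M" for i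
    using b by (auto simp: orthonormal_def l2_space_scale)
  have dist: "(l2_norm M (\<lambda>t. h t - (\<Sum>i\<in>F. c i * b i t)))\<^sup>2
      = (l2_norm M h)\<^sup>2 - (\<Sum>i\<in>F. (cmod (c i))\<^sup>2)"
    if F: "finite F" for F
  proof -
    define s where "s = (\<lambda>t. \<Sum>i\<in>F. c i * b i t)"
    have s: "s \<in> l2_space M" unfolding s_def using bs by (intro l2_space_sum)
    have sb: "l2_inner M s (b i) = c i" if "i \<in> F" for i
    proof -
      have "l2_inner M s (b i) = (\<Sum>j\<in>F. c j * l2_inner M (b j) (b i))"
        unfolding s_def using bs by (simp add: l2_inner_sum_left l2_inner_scale_left)
      also have "\<dots> = (\<Sum>j\<in>F. if j = i then c j else 0)"
        using b by (intro sum.cong) (auto simp: orthonormal_def)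
      finally show ?thesis using F that by simp
    qed
    have inner_s: "l2_inner M s u = (\<Sum>i\<in>F. c i * cnj (l2_inner M u (b i)))" if "u \<in> l2_space M"
        for u
    proof -
      have "l2_inner M s u = (\<Sum>i\<in>F. c i * l2_inner M (b i) u)"
        unfolding s_def using bs that by (simp add: l2_inner_sum_left l2_inner_scale_left)
      then show ?thesis by (simp add: l2_inner_commute[of M "b _" u])
    qed
    have hs: "(\<lambda>t. h t - s t) \<in> l2_space M" using h s by (rule l2_space_diff)
    have "l2_inner M s (\<lambda>t. h t - s t) = 0"
      unfolding inner_s[OF hs] using h s bs by (simp add: l2_inner_diff_left sb c_def)
    then have orth: "l2_inner M (\<lambda>t. h t - s t) s = 0"
      by (subst l2_inner_commute) simp
    have "complex_of_real ((l2_norm M s)\<^sup>2) = complex_of_real (\<Sum>i\<in>F. (cmod (c i))\<^sup>2)"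
      unfolding l2_inner_self[symmetric] inner_s[OF s] using sb
      by (simp add: complex_norm_square del: of_real_power)
    then have "(l2_norm M s)\<^sup>2 = (\<Sum>i\<in>F. (cmod (c i))\<^sup>2)"
      by (simp only: of_real_eq_iff)
    moreover have "(l2_norm M h)\<^sup>2 = (l2_norm M (\<lambda>t. h t - s t))\<^sup>2 + (l2_norm M s)\<^sup>2"
      using l2_norm_add_sq[OF hs s] orth by simp
    ultimately show ?thesis by (simp add: s_def)
  qed
  have "((\<lambda>F. sqrt ((l2_norm M h)\<^sup>2 - (\<Sum>i\<in>F. (cmod (c i))\<^sup>2))) \<longlongrightarrow> sqrt
      ((l2_norm M h)\<^sup>2 - (l2_norm M h)\<^sup>2))
      (finite_subsets_at_top UNIV)"
    using sum unfolding has_sum_def c_def by (intro tendsto_intros)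
  moreover have "\<forall>\<^sub>F F in finite_subsets_at_top UNIV. sqrt
      ((l2_norm M h)\<^sup>2 - (\<Sum>i\<in>F. (cmod (c i))\<^sup>2))
      = l2_norm M (\<lambda>t. h t - (\<Sum>i\<in>F. c i * b i t))"
    by (rule eventually_finite_subsets_at_top_weakI) (simp flip: dist)
  ultimately have "((\<lambda>F. l2_norm M (\<lambda>t. h t - (\<Sum>i\<in>F. c i * b i t))) \<longlongrightarrow> 0)
      (finite_subsets_at_top UNIV)"
    using Lim_transform_eventually by force
  then show ?thesis
    using h bs by (simp add: l2_has_sum_def c_def)
qed

section \<open>Closed subspaces and orthonormal bases\<close>

lemma l2_closure_mono: "S \<subseteq> T \<Longrightarrow> l2_closure M S \<subseteq> l2_closure M T"
  unfolding l2_closure_def by blast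

lemma l2_norm_zero [simp]: "l2_norm M (\<lambda>t. 0) = 0"
  by (simp add: l2_norm_def)

lemma l2_closure_superset: "S \<subseteq> l2_space M \<Longrightarrow> S \<subseteq> l2_closure M S"
  unfolding l2_closure_def by (auto intro!: bexI)

lemma l2_norm_diff_triangle:
  assumes "f \<in> l2_space M" "g \<in> l2_space M" "h \<in> l2_space M"
  shows "l2_norm M (\<lambda>t. f t - h t) \<le> l2_norm M (\<lambda>t. f t - g t) + l2_norm M (\<lambda>t. g t - h t)"
  using l2_norm_triangle[of "\<lambda>t. f t - g t" M "\<lambda>t. g t - h t"] assms by (simp add: l2_space_diff)

lemma l2_closure_idem: "l2_closure M (l2_closure M S) \<subseteq> l2_closure M S"
proof
  fix f assume f: "f \<in> l2_closure M (l2_closure M S)"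
  show "f \<in> l2_closure M S"
    unfolding l2_closure_def
  proof (intro CollectI conjI allI impI)
    show fs: "f \<in> l2_space M" using f by (simp add: l2_closure_def)
    fix \<epsilon> :: real assume "\<epsilon> > 0"
    then have "\<epsilon> / 2 > 0" by simp
    then obtain g where g: "g \<in> l2_closure M S" "l2_norm M (\<lambda>t. f t - g t) < \<epsilon> / 2"
      using f unfolding l2_closure_def by blast
    then obtain h where h: "h \<in> S \<inter> l2_space M" "l2_norm M (\<lambda>t. g t - h t) < \<epsilon> / 2"
      using \<open>\<epsilon> / 2 > 0\<close> unfolding l2_closure_def by blast
    have "l2_norm M (\<lambda>t. f t - h t) < \<epsilon>"
      using l2_norm_diff_triangle[of f M g h] fs g h by (simp add: l2_closure_def)
    with h show "\<exists>g\<in>S \<inter> l2_space M. l2_norm M (\<lambda>t. f t - g t) < \<epsilon>" by blast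
  qed
qed

lemma cfun_subspaceI:
  assumes "(\<lambda>t. 0) \<in> S" "\<And>f g. f \<in> S \<Longrightarrow> g \<in> S \<Longrightarrow> (\<lambda>t. f t + g t) \<in> S"
    "\<And>c f. f \<in> S \<Longrightarrow> (\<lambda>t. c * f t) \<in> S"
  shows "cfun.subspace S"
  using assms by (auto simp: cfun.subspace_def zero_fun_def plus_fun_def)

lemma cfun_subspaceD:
  assumes "cfun.subspace S"
  shows "(\<lambda>t. 0) \<in> S" "f \<in> S \<Longrightarrow> g \<in> S \<Longrightarrow> (\<lambda>t. f t + g t) \<in> S" "f \<in> S \<Longrightarrow> (\<lambda>t. c * f t) \<in> S"
  using assms by (auto simp: cfun.subspace_def zero_fun_def plus_fun_def)

lemma cfun_subspace_sum:
  assumes "cfun.subspace S" "\<And>n. n \<in> F \<Longrightarrow> g n \<in> S"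
  shows "(\<lambda>t. \<Sum>n\<in>F. c n * g n t) \<in> S"
  using assms
  by (induction F rule: infinite_finite_induct) (auto simp: cfun_subspaceD)

lemma subspace_l2_closure:
  assumes S: "cfun.subspace S"
  shows "cfun.subspace (l2_closure M S)"
proof (rule cfun_subspaceI)
  have "(\<lambda>t. 0::complex) \<in> S \<inter> l2_space M" using S by (simp add: cfun_subspaceD)
  moreover have "l2_norm M (\<lambda>t. 0) = 0" by (simp add: l2_norm_def)
  ultimately show "(\<lambda>t. 0) \<in> l2_closure M S"
    by (auto simp: l2_closure_def intro!: bexI[of _ "\<lambda>t. 0"])
next
  fix f g assume f: "f \<in> l2_closure M S" and g: "g \<in> l2_closure M S"
  show "(\<lambda>t. f t + g t) \<in> l2_closure M S"
    unfolding l2_closure_def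
  proof (intro CollectI conjI allI impI)
    show "(\<lambda>t. f t + g t) \<in> l2_space M"
      using f g by (simp add: l2_closure_def l2_space_add)
    fix \<epsilon> :: real assume "\<epsilon> > 0"
    then have e: "\<epsilon> / 2 > 0" by simp
    from f e obtain f' where f': "f' \<in> S \<inter> l2_space M" "l2_norm M (\<lambda>t. f t - f' t) < \<epsilon> / 2"
      unfolding l2_closure_def by blast
    from g e obtain g' where g': "g' \<in> S \<inter> l2_space M" "l2_norm M (\<lambda>t. g t - g' t) < \<epsilon> / 2"
      unfolding l2_closure_def by blast
    have "l2_norm M (\<lambda>t. (f t + g t) - (f' t + g' t)) \<le> 
      l2_norm M (\<lambda>t. f t - f' t) + l2_norm M (\<lambda>t. g t - g' t)"
      using l2_norm_triangle[of "\<lambda>t. f t - f' t" M "\<lambda>t. g t - g' t"] f g f' g'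
      by (simp add: l2_space_diff l2_closure_def algebra_simps)
    then show "\<exists>h\<in>S \<inter> l2_space M. l2_norm M (\<lambda>t. f t + g t - h t) < \<epsilon>"
      using f' g' S by (intro bexI[of _ "\<lambda>t. f' t + g' t"]) (auto simp: cfun_subspaceD l2_space_add)
  qed
next
  fix c f assume f: "f \<in> l2_closure M S"
  show "(\<lambda>t. c * f t) \<in> l2_closure M S"
    unfolding l2_closure_def
  proof (intro CollectI conjI allI impI)
    show "(\<lambda>t. c * f t) \<in> l2_space M"
      using f by (simp add: l2_closure_def l2_space_scale)
    fix \<epsilon> :: real assume "\<epsilon> > 0"
    then have e: "\<epsilon> / (cmod c + 1) > 0" by (simp add: add_nonneg_pos)
    from f e obtain f' where f': "f' \<in> S \<inter> l2_space M" "l2_norm M (\<lambda>t. f t - f' t) < \<epsilon> /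
        (cmod c + 1)"
      unfolding l2_closure_def by blast
    have "l2_norm M (\<lambda>t. c * f t - c * f' t) = cmod c * l2_norm M (\<lambda>t. f t - f' t)"
      using l2_norm_scale[of M c "\<lambda>t. f t - f' t"] by (simp add: right_diff_distrib)
    also have "\<dots> \<le> (cmod c + 1) * l2_norm M (\<lambda>t. f t - f' t)"
      by (simp add: mult_right_mono)
    also have "\<dots> < \<epsilon>"
      using f'(2) by (simp add: pos_less_divide_eq add_nonneg_pos mult.commute)
    finally show "\<exists>h\<in>S \<inter> l2_space M. l2_norm M (\<lambda>t. c * f t - h t) < \<epsilon>"
      using f' S by (intro bexI[of _ "\<lambda>t. c * f' t"]) (auto simp: cfun_subspaceD l2_space_scale)
  qed
qed

lemma l2_closure_span_subset:
  assumes V: "cfun.subspace V" "l2_closure M V = V" and S: "S \<subseteq> V"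
  shows "l2_closure M (cfun.span S) \<subseteq> V"
  using l2_closure_mono[OF cfun.span_minimal[OF S V(1)], of M] V(2) by simp

lemma l2_has_sum_in_closure:
  assumes "l2_has_sum M g f" "cfun.subspace S" "\<And>n. g n \<in> S"
  shows "f \<in> l2_closure M S"
  unfolding l2_closure_def
proof (intro CollectI conjI allI impI)
  show "f \<in> l2_space M" using assms by (simp add: l2_has_sum_def)
  fix \<epsilon> :: real assume "\<epsilon> > 0"
  have lim: "((\<lambda>F. l2_norm M (\<lambda>t. f t - (\<Sum>n\<in>F. g n t))) \<longlongrightarrow> 0) (finite_subsets_at_top UNIV)"
    and g: "\<And>n. g n \<in> l2_space M"
    using assms(1) by (auto simp: l2_has_sum_def)
  have "\<forall>\<^sub>F F in finite_subsets_at_top UNIV. l2_norm M (\<lambda>t. f t - (\<Sum>n\<in>F. g n t)) < \<epsilon>"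
    using order_tendstoD(2)[OF lim \<open>\<epsilon> > 0\<close>] .
  then obtain F where "l2_norm M (\<lambda>t. f t - (\<Sum>n\<in>F. g n t)) < \<epsilon>"
    using eventually_happens' finite_subsets_at_top_neq_bot by blast
  then show "\<exists>h\<in>S \<inter> l2_space M. l2_norm M (\<lambda>t. f t - h t) < \<epsilon>"
    using cfun_subspace_sum[OF assms(2), of F g "\<lambda>_. 1"] assms(3) g
    by (intro bexI[of _ "\<lambda>t. \<Sum>n\<in>F. g n t"]) (auto intro: l2_space_sum)
qed

text \<open>
  Used to extend orthogonality from a family of functions to its closed span.
\<close>

lemma l2_closed_orth:
  assumes "h \<in> l2_space M"
  defines "V \<equiv> {f \<in> l2_space M. l2_inner M f h = 0}"
  shows "cfun.subspace V" "l2_closure M V = V"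
proof -
  show "cfun.subspace V"
    unfolding V_def using assms
    by (intro cfun_subspaceI) (auto simp: l2_space_add l2_space_scale l2_inner_add_left
        l2_inner_scale_left)
  show "l2_closure M V = V"
  proof
    show "V \<subseteq> l2_closure M V" by (rule l2_closure_superset) (auto simp: V_def)
    show "l2_closure M V \<subseteq> V"
    proof
      fix f assume f: "f \<in> l2_closure M V"
      then have fs: "f \<in> l2_space M" by (simp add: l2_closure_def)
      have "cmod (l2_inner M f h) \<le> e" if "e > 0" for e
      proof -
        have "e / (l2_norm M h + 1) > 0" using that by (simp add: add_nonneg_pos)
        then obtain g where g: "g \<in> V" "l2_norm M (\<lambda>t. f t - g t) < e / (l2_norm M h + 1)"
          using f unfolding l2_closure_def by blast
        have gs: "g \<in> l2_space M" "l2_inner M g h = 0" using g by (auto simp: V_def)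
        then have "l2_inner M f h = l2_inner M (\<lambda>t. f t - g t) h"
          using fs assms by (simp add: l2_inner_diff_left)
        then have "cmod (l2_inner M f h) \<le> l2_norm M (\<lambda>t. f t - g t) * l2_norm M h"
          using l2_Cauchy_Schwarz[of "\<lambda>t. f t - g t" M h] fs gs assms by (simp add: l2_space_diff)
        also have "\<dots> \<le> l2_norm M (\<lambda>t. f t - g t) * (l2_norm M h + 1)"
          by (simp add: mult_left_mono)
        also have "\<dots> \<le> e"
          using g(2) by (simp add: pos_less_divide_eq add_nonneg_pos)
        finally show ?thesis .
      qed
      then have "l2_inner M f h = 0"
        by (metis field_le_epsilon norm_le_zero_iff add_0)
      then show "f \<in> V" using fs by (simp add: V_def)
    qed
  qed
qed

lemma orthonormal_basis_imp_orthonormal: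
  assumes "l2_orthonormal_basis M V e" "l2_closed_subspace M V"
  shows "orthonormal M e"
  using assms by (auto simp: l2_orthonormal_basis_def l2_closed_subspace_def orthonormal_def)

lemma orthonormal_basis_unimodular_imp:
  assumes V: "cfun.subspace V" and w: "\<And>n. cmod (w n) = 1" and e: "l2_orthonormal_basis M V e"
  shows "l2_orthonormal_basis M V (\<lambda>n t. w n * e n t)"
proof -
  have ww: "w n * cnj (w n) = 1" for n
    using complex_norm_square[of "w n"] w by simp
  have "e n \<in> cfun.span (range (\<lambda>n t. w n * e n t))" for n
  proof -
    have "(\<lambda>t. cnj (w n) * (w n * e n t)) \<in> cfun.span (range (\<lambda>n t. w n * e n t))"
      by (intro cfun.span_scale cfun.span_base) simp
    then show ?thesis
      using ww[of n] by (simp add: mult.commute[of "cnj (w n)"] flip: mult.assoc)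
  qed
  then have "cfun.span (range e) \<subseteq> cfun.span (range (\<lambda>n t. w n * e n t))"
    by (intro cfun.span_minimal cfun.subspace_span) auto
  then have "l2_closure M (cfun.span (range e)) \<subseteq> l2_closure M
      (cfun.span (range (\<lambda>n t. w n * e n t)))"
    by (rule l2_closure_mono)
  moreover have "l2_inner M (\<lambda>t. w m * e m t) (\<lambda>t. w n * e n t) = (if m = n then 1 else 0)" for m n
    using e ww[of n] by (simp add: l2_orthonormal_basis_def l2_inner_scale_left
        l2_inner_scale_right)
  ultimately show ?thesis
    using e cfun_subspaceD(3)[OF V] by (auto simp: l2_orthonormal_basis_def)
qed

text \<open>
  This discards the unimodular constants by which the LCST family differs from plain chirped
  translates.
\<close>

lemma orthonormal_basis_unimodular_iff:
  assumes V: "cfun.subspace V" and w: "\<And>n. cmod (w n) = 1"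
  shows "l2_orthonormal_basis M V (\<lambda>n t. w n * e n t) \<longleftrightarrow> l2_orthonormal_basis M V e"
proof
  assume "l2_orthonormal_basis M V (\<lambda>n t. w n * e n t)"
  then have "l2_orthonormal_basis M V (\<lambda>n t. inverse (w n) * (w n * e n t))"
    by (rule orthonormal_basis_unimodular_imp[OF V, rotated]) (simp add: norm_inverse w)
  moreover have "w n \<noteq> 0" for n using w[of n] by auto
  ultimately show "l2_orthonormal_basis M V e" by (simp flip: mult.assoc)
qed (rule orthonormal_basis_unimodular_imp[OF V w])

lemma subspace_orth_complement:
  assumes "cfun.subspace V'" "V' \<subseteq> l2_space M" "V \<subseteq> l2_space M"
  shows "cfun.subspace (l2_orth_complement M V V')"
proof (rule cfun_subspaceI)
  note V' = cfun_subspaceD[OF assms(1)]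
  show "(\<lambda>t. 0) \<in> l2_orth_complement M V V'"
    using V' by (simp add: l2_orth_complement_def)
  show "(\<lambda>t. f t + g t) \<in> l2_orth_complement M V V'"
    if "f \<in> l2_orth_complement M V V'" "g \<in> l2_orth_complement M V V'" for f g
  proof -
    have "l2_inner M (\<lambda>t. f t + g t) h = 0" if "h \<in> V" for h
      using that \<open>f \<in> _\<close> \<open>g \<in> _\<close> assms by (subst l2_inner_add_left)
          (auto simp: l2_orth_complement_def)
    then show ?thesis using that V' by (simp add: l2_orth_complement_def)
  qed
  show "(\<lambda>t. c * f t) \<in> l2_orth_complement M V V'" if "f \<in> l2_orth_complement M V V'" for c f
    using that V' by (simp add: l2_orth_complement_def l2_inner_scale_left)
qed

section \<open>Uniqueness of Fourier coefficients of integrable functions\<close>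

text \<open>
  For \<open>z\<close> of modulus 1 the integrals are the Fourier coefficients of the image of the complex
  measure \<open>h M\<close> under \<open>z\<close>, a measure on the unit circle.
\<close>

definition null_moments :: "'a measure \<Rightarrow> ('a \<Rightarrow> complex) \<Rightarrow> ('a \<Rightarrow> complex) set" where
  "null_moments M z = {h. integrable M h \<and> (\<forall>k::int. (LINT t|M. h t * z t powi k) = 0)}"

lemma integrable_mult_bounded:
  assumes "integrable M h" "g \<in> borel_measurable M" "\<And>t. cmod (g t) \<le> B"
  shows "integrable M (\<lambda>t. h t * (g t :: complex))"
proof (rule Bochner_Integration.integrable_bound)
  show "integrable M (\<lambda>t. B * cmod (h t))" using assms by simp
  show "(\<lambda>t. h t * g t) \<in> borel_measurable M"
    using assms borel_measurable_integrable by measurable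
  have "cmod (h t) * cmod (g t) \<le> cmod (h t) * \<bar>B\<bar>" for t
    using assms(3)[of t] by (intro mult_left_mono) auto
  then show "AE t in M. norm (h t * g t) \<le> norm (B * cmod (h t))"
    by (auto simp: norm_mult abs_mult mult.commute)
qed

context
  fixes M :: "'a measure" and z :: "'a \<Rightarrow> complex"
  assumes z_meas [measurable]: "z \<in> borel_measurable M" and z_norm: "\<And>t. cmod (z t) = 1"
begin

lemma z_nonzero: "z t \<noteq> 0"
  using z_norm[of t] by auto

lemma powi_measurable: "(\<lambda>t. z t powi k) \<in> borel_measurable M"
proof (cases "k \<ge> 0")
  case True
  then show ?thesis by (simp add: power_int_def)
next
  case False
  then show ?thesis by (simp add: power_int_def)
qed

lemma integrable_mult_powi:
  assumes "integrable M h"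
  shows "integrable M (\<lambda>t. h t * z t powi k)"
  using integrable_mult_bounded[OF assms powi_measurable, of k 1] z_norm
  by (simp add: norm_power_int)

lemma null_moments_add:
  assumes "f \<in> null_moments M z" "g \<in> null_moments M z"
  shows "(\<lambda>t. f t + g t) \<in> null_moments M z"
  using assms integrable_mult_powi by (auto simp: null_moments_def distrib_right)

lemma null_moments_scale:
  assumes "f \<in> null_moments M z"
  shows "(\<lambda>t. c * f t) \<in> null_moments M z"
  using assms by (auto simp: null_moments_def mult.assoc)

lemma null_moments_powi:
  assumes f: "f \<in> null_moments M z"
  shows "(\<lambda>t. f t * z t powi j) \<in> null_moments M z"
  unfolding null_moments_def
proof (intro CollectI conjI allI)
  show "integrable M (\<lambda>t. f t * z t powi j)"
    using f by (intro integrable_mult_powi) (simp add: null_moments_def)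
  fix k :: int
  have "f t * z t powi j * z t powi k = f t * z t powi (j + k)" for t
    by (simp add: power_int_add z_nonzero)
  then show "(LINT t|M. f t * z t powi j * z t powi k) = 0"
    using f by (simp only: null_moments_def mem_Collect_eq)
qed

text \<open>
  On the circle the coordinate functions are combinations of \<open>z\<close> and \<open>z\<^sup>-\<^sup>1\<close>. The class of
  functions \<open>h\<close> with vanishing moments is invariant under multiplication by powers of \<open>z\<close>; since
  the statement is made for all \<open>h\<close> of this class at once, products of polynomials are handled by
  applying the induction hypothesis twice.
\<close>

lemma null_moments_polynomial:
  assumes "real_polynomial_function q" "h \<in> null_moments M z"
  shows "(\<lambda>t. h t * of_real (q (z t))) \<in> null_moments M z"
  using assms
proof (induction arbitrary: h)
  case (linear f)
  define a b where "a = (of_real (f 1) - \<i> * of_real (f \<i>)) / 2"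
    and "b = (of_real (f 1) + \<i> * of_real (f \<i>)) / 2"
  have "h t * of_real (f (z t)) = a * (h t * z t powi 1) + b * (h t * z t powi (-1))" for t
  proof -
    have "z t = Re (z t) *\<^sub>R 1 + Im (z t) *\<^sub>R \<i>"
      by (simp add: complex_eq_iff)
    then have "f (z t) = f (Re (z t) *\<^sub>R 1 + Im (z t) *\<^sub>R \<i>)"
      by (rule arg_cong)
    also have "\<dots> = Re (z t) * f 1 + Im (z t) * f \<i>"
      using linear.hyps by (simp add: linear_simps)
    finally have f: "f (z t) = Re (z t) * f 1 + Im (z t) * f \<i>" .
    have "z t powi (-1) = cnj (z t)"
      using z_norm[of t] by (simp add: power_int_minus divide_conv_cnj inverse_eq_divide)
    then show ?thesis
      unfolding f a_def b_def power_int_1_right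
      by (simp only:) (simp add: complex_eq_iff field_simps)
  qed
  then show ?case
    using null_moments_add[OF null_moments_scale[OF null_moments_powi[OF linear.prems]]
        null_moments_scale[OF null_moments_powi[OF linear.prems]], of a 1 b "-1"] by simp
next
  case (const c)
  then show ?case using null_moments_scale[of h "of_real c"] by (simp add: mult.commute)
next
  case (add f g)
  then show ?case using null_moments_add[OF add.IH(1) add.IH(2), of h h] by (simp add: distrib_left)
next
  case (mult f g)
  then show ?case using mult.IH(2)[OF mult.IH(1)[of h]] by (simp add: mult.assoc)
qed

text \<open>
  Real polynomials approximate \<open>g\<close> uniformly on the circle, by the Stone-Weierstrass theorem.
\<close>

lemma null_moments_continuous:
  assumes h: "h \<in> null_moments M z" and g: "continuous_on UNIV g"
  shows "(LINT t|M. h t * complex_of_real (g (z t))) = 0"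
proof -
  have ih: "integrable M h" using h by (simp add: null_moments_def)
  have [measurable]: "g \<in> borel_measurable borel" using g by (rule borel_measurable_continuous_onI)
  have gs: "continuous_on (sphere 0 1) g" using g continuous_on_subset by blast
  have cs: "compact (sphere (0::complex) 1)" by simp
  obtain B where B: "\<And>w. w \<in> sphere 0 1 \<Longrightarrow> norm (g w) \<le> B"
    using compact_imp_bounded[OF compact_continuous_image[OF gs cs]] by (force simp: bounded_iff)
  have ig: "integrable M (\<lambda>t. h t * complex_of_real (g (z t)))"
    by (rule integrable_mult_bounded[OF ih, of _ B]) (use B z_norm in \<open>auto simp: norm_of_real\<close>)
  have "cmod (LINT t|M. h t * complex_of_real (g (z t))) \<le> e * (LINT t|M. cmod (h t))" if e: "e >
      0" for e
  proof -
    obtain q where q: "real_polynomial_function q" "\<And>w. w \<in> sphere 0 1 \<Longrightarrow> \<bar>g w - q w\<bar> < e"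
      using Stone_Weierstrass_real_polynomial_function[OF cs gs e] by blast
    have hq: "(\<lambda>t. h t * of_real (q (z t))) \<in> null_moments M z"
      by (rule null_moments_polynomial[OF q(1) h])
    then have iq: "integrable M (\<lambda>t. h t * of_real (q (z t)))"
        "(LINT t|M. h t * of_real (q (z t))) = 0"
      by (auto simp: null_moments_def dest: spec[of _ 0])
    have "(LINT t|M. h t * complex_of_real (g (z t)))
        = (LINT t|M. h t * complex_of_real (g (z t)) - h t * of_real (q (z t)))"
      using ig iq by simp
    also have "cmod \<dots> \<le> (LINT t|M. cmod (h t * complex_of_real (g (z t)) - h t * of_real
        (q (z t))))"
      by (rule integral_norm_bound)
    also have "\<dots> \<le> (LINT t|M. e * cmod (h t))"
    proof (rule integral_mono)
      fix t
      have "cmod (h t * complex_of_real (g (z t)) - h t * of_real (q (z t)))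
          = cmod (h t) * \<bar>g (z t) - q (z t)\<bar>"
        by (simp add: norm_mult flip: right_diff_distrib of_real_diff)
      also have "\<dots> \<le> cmod (h t) * e"
        using q(2)[of "z t"] z_norm by (intro mult_left_mono) auto
      finally show "cmod (h t * complex_of_real (g (z t)) - h t * of_real (q (z t))) \<le> e * cmod
          (h t)"
        by (simp add: mult.commute)
    qed (use ig iq ih in auto)
    finally show ?thesis by simp
  qed
  note bd = this
  define I where "I = (LINT t|M. cmod (h t))"
  have "I \<ge> 0" by (simp add: I_def)
  have "cmod (LINT t|M. h t * complex_of_real (g (z t))) \<le> 0 + d" if "d > 0" for d
  proof -
    have "d / (I + 1) * I \<le> d"
      using that \<open>I \<ge> 0\<close> by (simp add: field_simps)
    then show ?thesis
      using bd[of "d / (I + 1)"] that \<open>I \<ge> 0\<close> by (simp add: I_def[symmetric])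
  qed
  then have "cmod (LINT t|M. h t * complex_of_real (g (z t))) \<le> 0"
    by (rule field_le_epsilon)
  then show ?thesis by simp
qed

text \<open>
  The indicator function of a closed set is the pointwise limit of the continuous functions
  \<open>max 0 (1 - j dist(w, C))\<close>, which are bounded by 1, so dominated convergence applies.
\<close>

lemma null_moments_closed:
  assumes h: "h \<in> null_moments M z" and C: "closed C"
  shows "(LINT t|M. h t * indicator C (z t)) = 0"
proof (cases "C = {}")
  case False
  define g where "g j w = max 0 (1 - real j * infdist w C)" for j w
  have gc: "continuous_on UNIV (g j)" for j
    unfolding g_def by (intro continuous_intros)
  have [measurable]: "g j \<in> borel_measurable borel" for j
    using gc by (rule borel_measurable_continuous_onI)
  have [measurable]: "C \<in> sets borel" using C by simp
  have ih[measurable]: "integrable M h" using h by (simp add: null_moments_def)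
  have g01: "0 \<le> g j w" "g j w \<le> 1" for j w
    by (auto simp: g_def infdist_nonneg)
  have lim: "(\<lambda>j. g j w) \<longlonglongrightarrow> indicator C w" for w
  proof (cases "w \<in> C")
    case True
    then show ?thesis by (simp add: g_def)
  next
    case False
    then have "infdist w C > 0"
      using C \<open>C \<noteq> {}\<close> in_closed_iff_infdist_zero[of C w] infdist_nonneg[of w C] by force
    then obtain N :: nat where N: "real N * infdist w C > 1"
      using reals_Archimedean3 by blast
    have "\<forall>\<^sub>F j in sequentially. g j w = 0"
      unfolding eventually_sequentially
    proof (intro exI allI impI)
      fix j assume "N \<le> j"
      then have "real N * infdist w C \<le> real j * infdist w C"
        by (intro mult_right_mono) (auto simp: infdist_nonneg)
      with N show "g j w = 0" by (simp add: g_def)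
    qed
    with False show ?thesis by (simp add: tendsto_eventually)
  qed
  have "(\<lambda>j. LINT t|M. h t * complex_of_real (g j (z t))) \<longlonglongrightarrow>
      (LINT t|M. h t * complex_of_real (indicator C (z t)))"
  proof (rule integral_dominated_convergence[where w = "\<lambda>t. cmod (h t)"])
    show "AE t in M. (\<lambda>j. h t * complex_of_real (g j (z t))) \<longlonglongrightarrow> h t * complex_of_real
        (indicator C (z t))"
      by (intro always_eventually allI tendsto_intros lim)
    show "AE t in M. norm (h t * complex_of_real (g j (z t))) \<le> cmod (h t)" for j
      using g01 by (auto simp: norm_mult intro!: mult_left_le)
  qed (use ih in \<open>auto intro!: borel_measurable_times borel_measurable_of_real simp:
      borel_measurable_integrable\<close>)
  then have "(\<lambda>j. 0::complex) \<longlonglongrightarrow> (LINT t|M. h t * complex_of_real (indicator C (z t)))"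
    by (simp add: null_moments_continuous[OF h gc])
  then have "(LINT t|M. h t * complex_of_real (indicator C (z t))) = 0"
    using LIMSEQ_unique tendsto_const by blast
  then show ?thesis by (simp add: of_real_indicator)
qed simp

end

text \<open>
  If \<open>f\<close> were positive on a set of positive measure, then by inner regularity it would be positive
  on a compact set of positive measure, and the integral over this set would not vanish.
\<close>

lemma AE_nonpos_if_integral_compact_zero:
  fixes f :: "real \<Rightarrow> real"
  assumes f: "integrable lborel f"
    and zero: "\<And>K. compact K \<Longrightarrow> K \<subseteq> {a..<b} \<Longrightarrow> (LINT t|lborel. indicator K t * f t) = 0"
  shows "AE t in lborel. t \<in> {a..<b} \<longrightarrow> f t \<le> 0"
proof -
  have [measurable]: "f \<in> borel_measurable borel" using f by auto
  define S where "S = {t \<in> {a..<b}. f t > 0}"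
  have S[measurable]: "S \<in> sets borel" unfolding S_def by measurable
  have fin: "emeasure lborel S < \<infinity>"
  proof (rule le_less_trans)
    show "emeasure lborel S \<le> emeasure lborel {a..b}"
      by (rule emeasure_mono) (auto simp: S_def)
  qed (simp add: emeasure_lborel_Icc_eq)
  have "emeasure lborel S = 0"
  proof (rule ccontr)
    assume "emeasure lborel S \<noteq> 0"
    then have "0 < emeasure lborel S"
      by (simp only: zero_less_iff_neq_zero simp_thms)
    moreover have m: "emeasure lborel S = ennreal (measure lborel S)"
      using fin by (intro emeasure_eq_ennreal_measure) simp
    ultimately have "measure lborel S > 0"
      by simp
    note m = this m
    obtain K where K: "closed K" "K \<subseteq> S" "emeasure lebesgue (S - K) < ennreal (measure lborel S)"
    proof (rule sets_lebesgue_inner_closed)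
      show "S \<in> sets lebesgue" using S by simp
      show "measure lborel S > 0" by (rule m(1))
    qed
    have [measurable]: "K \<in> sets borel" using K by simp
    have "bounded K" using K by (intro bounded_subset[of "{a..b}" K]) (auto simp: S_def)
    then have "compact K" using K by (simp add: compact_eq_bounded_closed)
    then have "(LINT t|lborel. indicator K t * f t) = 0"
      by (rule zero) (use K in \<open>auto simp: S_def\<close>)
    moreover have "integrable lborel (\<lambda>t. indicator K t * f t)"
      using integrable_mult_indicator[of K lborel f] f by simp
    moreover have "indicator K t * f t \<ge> 0" for t
      using K by (auto simp: S_def indicator_def)
    ultimately have "AE t in lborel. indicator K t * f t = 0"
      using integral_nonneg_eq_0_iff_AE[of lborel "\<lambda>t. indicator K t * f t"] by simp
    then have "AE t in lborel. t \<notin> K"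
      by eventually_elim (use K in \<open>auto simp: S_def indicator_def split: if_splits\<close>)
    then have "emeasure lborel K = 0"
      by (subst (asm) AE_iff_measurable[of K]) auto
    then have "emeasure lborel S \<le> emeasure lborel (S - K)"
      using emeasure_subadditive[of K lborel "S - K"] K(2) by (simp add: Un_absorb1)
    moreover have "emeasure lborel (S - K) = emeasure lebesgue (S - K)"
      by simp
    ultimately show False using K(3) m(2) by (metis leD)
  qed
  then have "AE t in lborel. t \<notin> S"
    by (subst AE_iff_measurable[of S]) auto
  then show ?thesis by eventually_elim (auto simp: S_def)
qed

text \<open>
  The map \<open>z\<close> winding the half-open interval once around the circle is injective, so every compact
  subset \<open>K\<close> of the interval is the preimage of the closed set \<open>z ` K\<close>. Hence the integral of
  \<open>h\<close> over every such \<open>K\<close> vanishes.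
\<close>

lemma Fourier_uniqueness:
  fixes h :: "real \<Rightarrow> complex"
  assumes L: "L > 0" and h: "integrable (restrict_space lborel {q..q+L}) h"
    and zero: "\<And>k::int. (LINT t|restrict_space lborel {q..q+L}. h t * cis (2 * pi * k * t / L)) = 0"
  shows "AE t in lborel. t \<in> {q..<q+L} \<longrightarrow> h t = 0"
proof -
  define M where "M = restrict_space lborel {q..q+L}"
  define z where "z t = cis (2 * pi * t / L)" for t
  have zc: "continuous_on S z" for S
    unfolding z_def cis_conv_exp by (intro continuous_intros) (use L in auto)
  have zb: "z \<in> borel_measurable borel" by (rule borel_measurable_continuous_onI) (rule zc)
  have zm: "z \<in> borel_measurable M"
    unfolding M_def by (rule measurable_restrict_space1) (use zb in simp)
  have hz: "h \<in> null_moments M z"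
    using h zero by (simp add: null_moments_def M_def z_def cis_power_int mult_ac)
  have I[measurable]: "{q..q+L} \<in> sets borel" by simp
  define H where "H t = indicator {q..q+L} t *\<^sub>R h t" for t
  have H: "integrable lborel H"
    using h unfolding H_def by (simp add: integrable_restrict_space)
  have K0: "(LINT t|lborel. indicator K t *\<^sub>R H t) = 0" if K: "compact K" "K \<subseteq> {q..<q+L}" for K
  proof -
    have "closed (z ` K)" using compact_continuous_image[OF zc K(1)] by (rule compact_imp_closed)
    then have "(LINT t|M. h t * indicator (z ` K) (z t)) = 0"
      by (intro null_moments_closed[OF zm _ hz]) (auto simp: z_def)
    then have "(LINT t|lborel. indicator {q..q+L} t *\<^sub>R (h t * indicator (z ` K) (z t))) = 0"
      unfolding M_def by (subst (asm) integral_restrict_space) auto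
    also have "(LINT t|lborel. indicator {q..q+L} t *\<^sub>R (h t * indicator (z ` K) (z t)))
        = (LINT t|lborel. indicator K t *\<^sub>R H t)"
    proof (rule integral_cong_AE)
      have inj: "t = s" if "z t = z s" "t \<in> {q..<q+L}" "s \<in> {q..<q+L}" for s t
      proof -
        obtain n :: int where n: "2 * pi * t / L = 2 * pi * s / L + 2 * pi * n"
          using \<open>z t = z s\<close> sin_cos_eq_iff[of "2 * pi * t / L" "2 * pi * s / L"]
          by (auto simp: z_def complex_eq_iff)
        then have "2 * pi * ((t - s) / L) = 2 * pi * n"
            by (simp add: algebra_simps diff_divide_distrib)
        then have "(t - s) / L = n" by (simp del: times_divide_eq_right)
        then have "t - s = n * L" using L by (simp add: field_simps)
        moreover have "\<bar>t - s\<bar> < L" using that by auto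
        ultimately have "\<bar>real_of_int n\<bar> < 1" using L by (simp add: abs_mult)
        then have "n = 0" by linarith
        with \<open>t - s = n * L\<close> show ?thesis by simp
      qed
      show "AE t in lborel. indicator {q..q+L} t *\<^sub>R (h t * indicator (z ` K) (z t))
          = indicator K t *\<^sub>R H t"
        using AE_lborel_singleton[of "q+L"]
      proof eventually_elim
        case (elim t)
        have "t \<in> K" if t: "t \<in> {q..q+L}" and zt: "z t \<in> z ` K"
        proof -
          obtain s where s: "s \<in> K" "z t = z s" using zt by blast
          have "t \<in> {q..<q+L}" using t elim by auto
          then show ?thesis using inj[OF s(2)] s(1) K(2) by blast
        qed
        then have "indicator {q..q+L} t * indicator (z ` K) (z t)
            = (indicator {q..q+L} t * indicator K t :: real)"
          by (auto simp: indicator_def)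
        then show ?case
          by (auto simp: H_def indicator_def split: if_splits)
      qed
      have "(\<lambda>t. indicator (z ` K) (z t) :: complex) \<in> borel_measurable borel"
        using \<open>closed (z ` K)\<close> by (intro measurable_compose[OF zb borel_measurable_indicator]) simp
      then have "(\<lambda>t. H t * indicator (z ` K) (z t)) \<in> borel_measurable lborel"
        using borel_measurable_integrable[OF H] by simp
      then show "(\<lambda>t. indicator {q..q+L} t *\<^sub>R (h t * indicator (z ` K) (z t))) \<in>
          borel_measurable lborel"
        by (simp add: H_def)
      show "(\<lambda>t. indicator K t *\<^sub>R H t) \<in> borel_measurable lborel"
        using borel_measurable_integrable[OF H] compact_imp_closed[OF K(1)] by simp
    qed
    finally show ?thesis by simp
  qed
  have iK: "integrable lborel (\<lambda>t. indicator K t *\<^sub>R H t)" if "compact K" for K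
    using borel_closed[OF compact_imp_closed[OF that]] by (intro integrable_mult_indicator H) simp
  have real: "AE t in lborel. t \<in> {q..<q+L} \<longrightarrow> l (H t) \<le> 0" if l: "bounded_linear l" for l ::
      "complex \<Rightarrow> real"
  proof (rule AE_nonpos_if_integral_compact_zero)
    show "integrable lborel (\<lambda>t. l (H t))" using l H by (rule integrable_bounded_linear)
    fix K assume K: "compact K" "K \<subseteq> {q..<q+L}"
    have "(LINT t|lborel. indicator K t * l (H t)) = (LINT t|lborel. l (indicator K t *\<^sub>R H t))"
      by (simp add: linear_scale[OF bounded_linear.linear[OF l]])
    also have "\<dots> = l (LINT t|lborel. indicator K t *\<^sub>R H t)"
      by (rule integral_bounded_linear[OF l iK[OF K(1)]])
    also have "\<dots> = 0"
      by (simp add: K0[OF K] linear_0[OF bounded_linear.linear[OF l]])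
    finally show "(LINT t|lborel. indicator K t * l (H t)) = 0" .
  qed
  have "AE t in lborel. t \<in> {q..<q+L} \<longrightarrow> Re (H t) = 0 \<and> Im (H t) = 0"
    using real[OF bounded_linear_Re] real[OF bounded_linear_minus[OF bounded_linear_Re]]
      real[OF bounded_linear_Im] real[OF bounded_linear_minus[OF bounded_linear_Im]]
    by eventually_elim auto
  then show ?thesis
  proof eventually_elim
    case (elim t)
    then show ?case
      by (cases "t \<in> {q..q+L}") (simp_all add: H_def complex_eq_iff)
  qed
qed

section \<open>Complex exponentials on a period\<close>

text \<open>
  The exponentials occurring in \<open>\<Lambda>\<close> and \<open>\<Gamma>\<close>, with \<open>B = B2\<close>; since \<open>B\<close> may be negative, the
  common period is \<open>2\<pi>|B|\<close>.
\<close>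

definition trig :: "real \<Rightarrow> int \<Rightarrow> real \<Rightarrow> complex" where
  "trig B n u = cis (- (real_of_int n * u / B))"

abbreviation period_measure :: "real \<Rightarrow> real \<Rightarrow> real measure" where
  "period_measure B p \<equiv> restrict_space lborel {p..p + 2 * pi * \<bar>B\<bar>}"

lemma norm_trig [simp]: "cmod (trig B n u) = 1"
  by (simp add: trig_def)

lemma trig_mult: "trig B m u * trig B n u = trig B (m + n) u"
  by (simp add: trig_def cis_mult add_divide_distrib distrib_right)

lemma cnj_trig: "cnj (trig B n u) = trig B (- n) u"
  by (simp add: trig_def cis_cnj)

lemma trig_0 [simp]: "trig B 0 u = 1"
  by (simp add: trig_def)

lemma continuous_trig: "continuous_on S (trig B n)"
  unfolding trig_def cis_conv_exp divide_inverse by (intro continuous_intros)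

lemma trig_measurable [measurable]: "trig B n \<in> borel_measurable borel"
  by (rule borel_measurable_continuous_onI) (rule continuous_trig)

lemma cis_int_pi: "cis (real_of_int n * pi) = (-1) powi n"
  using cis_power_int[of pi n] by simp

lemma trig_add_half_period:
  assumes "B \<noteq> 0"
  shows "trig B n (u + pi * \<bar>B\<bar>) = (-1) powi n * trig B n u"
proof -
  have "- (real_of_int n * (u + pi * \<bar>B\<bar>) / B)
      = - (real_of_int n * u / B) + real_of_int (- n * (if B > 0 then 1 else -1)) * pi"
    using assms by (simp add: field_simps)
  then have "trig B n (u + pi * \<bar>B\<bar>) = trig B n u * cis
      (real_of_int (- n * (if B > 0 then 1 else -1)) * pi)"
    by (simp only: trig_def cis_mult)
  also have "cis (real_of_int (- n * (if B > 0 then 1 else -1)) * pi) = (-1) powi n"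
    unfolding cis_int_pi by (simp add: power_int_minus_one_minus)
  finally show ?thesis by simp
qed

lemma cis_even_multiple_pi: "cis (2 * pi * real_of_int n) = 1"
  by (rule cis_multiple_2pi) simp

lemma restrict_translate:
  fixes g :: "real \<Rightarrow> 'b::{banach, second_countable_topology}"
  shows "integrable (restrict_space lborel {a..b}) (\<lambda>t. g (t + r))
      \<longleftrightarrow> integrable (restrict_space lborel {a + r..b + r}) g"
    and "(LINT t|restrict_space lborel {a..b}. g (t + r))
        = (LINT t|restrict_space lborel {a + r..b + r}. g t)"
proof -
  have ind: "indicator {a + r..b + r} (t + r) = (indicator {a..b} t :: real)" for t
    by (auto simp: indicator_def)
  show "integrable (restrict_space lborel {a..b}) (\<lambda>t. g (t + r))
      \<longleftrightarrow> integrable (restrict_space lborel {a + r..b + r}) g"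
    using lborel_integrable_real_affine_iff[of 1 "\<lambda>t. indicator {a + r..b + r} t *\<^sub>R g t" r]
    by (simp add: integrable_restrict_space add.commute[of r] ind)
  show "(LINT t|restrict_space lborel {a..b}. g (t + r))
      = (LINT t|restrict_space lborel {a + r..b + r}. g t)"
    using lborel_integral_real_affine[of 1 "\<lambda>t. indicator {a + r..b + r} t *\<^sub>R g t" r]
    by (simp add: integral_restrict_space add.commute[of r] ind)
qed

lemma integral_cis_over_period:
  assumes L: "L > 0" and s: "s \<noteq> 0" "cis (s * L) = 1"
  shows "(LINT t|restrict_space lborel {q..q+L}. cis (s * t)) = 0"
proof -
  have d: "((\<lambda>t. cis (s * t) / (\<i> * s)) has_vector_derivative cis (s * t))
      (at t within {q..q+L})" for t
  proof -
    have "((\<lambda>t. exp (\<i> * complex_of_real s * of_real t) / (\<i> * s)) has_vector_derivative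
        exp (\<i> * s * of_real t)) (at t within {q..q+L})"
      by (rule has_vector_derivative_real_field)
         (use s in \<open>auto intro!: derivative_eq_intros\<close>)
    then show ?thesis by (simp add: cis_conv_exp mult.assoc)
  qed
  have "continuous_on {q..q+L} (\<lambda>t. cis (s * t))"
    unfolding cis_conv_exp by (intro continuous_intros)
  then have "(LINT t|lborel. indicator {q..q+L} t *\<^sub>R cis (s * t))
      = cis (s * (q + L)) / (\<i> * s) - cis (s * q) / (\<i> * s)"
    using L d by (intro integral_FTC_atLeastAtMost) auto
  also have "cis (s * (q + L)) = cis (s * q)"
    using s(2) by (simp add: distrib_left flip: cis_mult)
  finally show ?thesis
    by (simp add: integral_restrict_space)
qed

lemma integral_trig_period:
  assumes "B \<noteq> 0"
  shows "(LINT t|period_measure B p. trig B n t) = (if n = 0 then 2 * pi * \<bar>B\<bar> else 0)"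
proof (cases "n = 0")
  case False
  have "- (real_of_int n / B) * (2 * pi * \<bar>B\<bar>)
      = 2 * pi * real_of_int (- n * (if B > 0 then 1 else -1))"
    using assms by (simp add: field_simps)
  then have "cis (- (real_of_int n / B) * (2 * pi * \<bar>B\<bar>)) = 1"
    by (simp only: cis_even_multiple_pi)
  then have "(LINT t|period_measure B p. cis (- (real_of_int n / B) * t)) = 0"
    using assms False by (intro integral_cis_over_period) auto
  then show ?thesis using False by (simp add: trig_def)
qed (simp add: measure_restrict_space scaleR_conv_of_real)

lemma integral_trig_half_period:
  assumes "B \<noteq> 0"
  shows "(LINT t|restrict_space lborel {p..p + pi * \<bar>B\<bar>}. trig B (2 * n) t)
      = (if n = 0 then pi * \<bar>B\<bar> else 0)"
proof (cases "n = 0")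
  case False
  have "- (2 * real_of_int n / B) * (pi * \<bar>B\<bar>)
      = 2 * pi * real_of_int (- n * (if B > 0 then 1 else -1))"
    using assms by (simp add: field_simps)
  then have "cis (- (2 * real_of_int n / B) * (pi * \<bar>B\<bar>)) = 1"
    by (simp only: cis_even_multiple_pi)
  then have "(LINT t|restrict_space lborel {p..p + pi * \<bar>B\<bar>}. cis
      (- (2 * real_of_int n / B) * t)) = 0"
    using assms False by (intro integral_cis_over_period) auto
  then show ?thesis using False by (simp add: trig_def)
qed (simp add: measure_restrict_space scaleR_conv_of_real)

lemma finite_measure_period: "finite_measure (restrict_space lborel {a..b::real})"
  by (rule finite_measureI) (simp add: emeasure_restrict_space space_restrict_space
      emeasure_lborel_Icc_eq)

lemma trig_in_l2: "trig B n \<in> l2_space (restrict_space lborel {a..b})"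
proof -
  interpret finite_measure "restrict_space lborel {a..b::real}" by (rule finite_measure_period)
  show ?thesis
    by (auto simp: l2_space_def intro!: measurable_restrict_space1)
qed

lemma trig_orthogonal:
  assumes "B \<noteq> 0"
  shows "l2_inner (period_measure B p) (trig B m) (trig B n)
      = (if m = n then complex_of_real (2 * pi * \<bar>B\<bar>) else 0)"
  using integral_trig_period[OF assms, of p "m - n"]
  by (simp add: l2_inner_def cnj_trig trig_mult)

text \<open>
  Shifting the coefficients by \<open>j\<close> corresponds to multiplying the function by the \<open>j\<close>-th
  exponential.
\<close>

lemma l2_has_sum_mult_trig:
  assumes "l2_has_sum (restrict_space lborel {a..b}) (\<lambda>n u. x n * trig B n u) X"
  shows "l2_has_sum (restrict_space lborel {a..b}) (\<lambda>n u. x (n - j) * trig B n u)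
      (\<lambda>u. trig B j u * X u)"
proof -
  have m: "trig B j \<in> borel_measurable (restrict_space lborel {a..b})"
    using trig_in_l2 by (auto simp: l2_space_def)
  have "l2_has_sum (restrict_space lborel {a..b}) (\<lambda>n u. trig B j u * (x n * trig B n u))
      (\<lambda>u. trig B j u * X u)"
    by (rule l2_has_sum_transform[OF assms, where K = 1])
       (use m in \<open>auto simp: l2_space_def l2_norm_def norm_mult\<close>)
  moreover have "bij (\<lambda>n::int. n - j)"
    by (rule bij_betw_byWitness[where f' = "\<lambda>n. n + j"]) auto
  ultimately have "l2_has_sum (restrict_space lborel {a..b})
      (\<lambda>n u. trig B j u * (x (n - j) * trig B (n - j) u)) (\<lambda>u. trig B j u * X u)"
    by (rule l2_has_sum_reindex)
  moreover have "trig B j u * (x (n - j) * trig B (n - j) u) = x (n - j) * trig B n u" for n u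
    using trig_mult[of B j u "n - j"] by (simp add: mult.left_commute)
  ultimately show ?thesis by simp
qed

text \<open>
  The substitution \<open>u + \<pi>|B|\<close> multiplies the \<open>n\<close>-th exponential by \<open>(-1)\<^sup>n\<close> and carries the
  period starting at \<open>p\<close> to the one starting at \<open>p + \<pi>|B|\<close>.
\<close>

lemma l2_has_sum_half_period_shift:
  assumes "B \<noteq> 0"
    and "l2_has_sum (period_measure B (p + pi * \<bar>B\<bar>)) (\<lambda>n u. x n * trig B n u) X"
  shows "l2_has_sum (period_measure B p) (\<lambda>n u. x n * (-1) powi n * trig B n u)
      (\<lambda>u. X (u + pi * \<bar>B\<bar>))"
proof -
  define H where "H = pi * \<bar>B\<bar>"
  have PM: "period_measure B p = restrict_space lborel {p..p + 2 * H}"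
    "period_measure B (p + H) = restrict_space lborel {p + H..p + 2 * H + H}"
    by (simp_all add: H_def algebra_simps)
  note translate = restrict_translate[of p "p + 2 * H" _ H, folded PM]
  have "l2_has_sum (period_measure B p) (\<lambda>n u. 1 * (x n * trig B n (u + H))) (\<lambda>u. 1 * X (u + H))"
  proof (rule l2_has_sum_transform[where K = 1])
    show "l2_has_sum (period_measure B (p + H)) (\<lambda>n u. x n * trig B n u) X"
      using assms(2) by (simp add: H_def)
    fix f assume f: "f \<in> l2_space (period_measure B (p + H))"
    have "(\<lambda>t. f (t + H)) \<in> borel_measurable (period_measure B p)"
    proof (rule measurable_compose[where f = "\<lambda>t. t + H" and g = f])
      show "(\<lambda>t. t + H) \<in> period_measure B p \<rightarrow>\<^sub>M period_measure B (p + H)"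
        unfolding PM by (rule measurable_restrict_space3) auto
      show "f \<in> borel_measurable (period_measure B (p + H))" using f by (simp add: l2_space_def)
    qed
    then show "(\<lambda>t. 1 * f (t + H)) \<in> l2_space (period_measure B p)"
      using f translate(1)[of "\<lambda>t. (cmod (f t))\<^sup>2"] by (simp add: l2_space_def)
    show "l2_norm (period_measure B p) (\<lambda>t. 1 * f (t + H))
        = 1 * l2_norm (period_measure B (p + H)) f"
      using translate(2)[of "\<lambda>t. (cmod (f t))\<^sup>2"] by (simp add: l2_norm_def)
  qed
  then show ?thesis
    by (simp only: trig_add_half_period[OF assms(1), folded H_def] H_def[symmetric] mult.assoc
        mult_1)
qed

lemma integral_fold:
  fixes w :: "real \<Rightarrow> complex"
  assumes H: "H > 0" and w: "integrable (restrict_space lborel {p..p + 2 * H}) w"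
  shows "integrable (restrict_space lborel {p..p + H}) (\<lambda>v. w v + w (v + H))"
    and "(LINT v|restrict_space lborel {p..p + 2 * H}. w v)
        = (LINT v|restrict_space lborel {p..p + H}. w v + w (v + H))"
proof -
  let ?W = "\<lambda>v. indicator {p..p + 2 * H} v *\<^sub>R w v"
  have W: "integrable lborel ?W" using w by (simp add: integrable_restrict_space)
  have sub: "integrable lborel (\<lambda>v. indicator {a..b} v *\<^sub>R w v)" if "p \<le> a" "b \<le> p + 2 * H" for a b
  proof -
    have "integrable lborel (\<lambda>v. indicator {a..b} v *\<^sub>R ?W v)"
      by (rule integrable_mult_indicator[OF _ W]) simp
    moreover have "indicator {a..b} v *\<^sub>R ?W v = indicator {a..b} v *\<^sub>R w v" for v
      using that by (auto simp: indicator_def)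
    ultimately show ?thesis by (simp only:)
  qed
  have 1: "integrable lborel (\<lambda>v. indicator {p..p + H} v *\<^sub>R w v)"
    and 2: "integrable lborel (\<lambda>v. indicator {p + H..p + H + H} v *\<^sub>R w v)"
    by (rule sub; use H in simp)+
  have 3: "integrable lborel (\<lambda>v. indicator {p..p + H} v *\<^sub>R w (v + H))"
    and 4: "(LINT v|lborel. indicator {p + H..p + H + H} v *\<^sub>R w v)
        = (LINT v|lborel. indicator {p..p + H} v *\<^sub>R w (v + H))"
    using restrict_translate[of p "p + H" w H] 2
    by (simp_all add: integrable_restrict_space integral_restrict_space)
  show "integrable (restrict_space lborel {p..p + H}) (\<lambda>v. w v + w (v + H))"
    using 1 3 by (simp add: integrable_restrict_space scaleR_add_right)
  have "(LINT v|lborel. ?W v) = (LINT v|lborel. indicator {p..p + H} v *\<^sub>R w v + indicator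
      {p + H..p + H + H} v *\<^sub>R w v)"
  proof (rule integral_cong_AE)
    show "AE v in lborel. ?W v = indicator {p..p + H} v *\<^sub>R w v + indicator {p + H..p + H + H} v
        *\<^sub>R w v"
      using AE_lborel_singleton[of "p + H"]
      by eventually_elim (use H in \<open>auto simp: indicator_def\<close>)
  qed (use W 1 2 in \<open>auto dest!: borel_measurable_integrable\<close>)
  also have "\<dots> = (LINT v|lborel. indicator {p..p + H} v *\<^sub>R (w v + w (v + H)))"
    using 1 2 3 4 by (simp add: scaleR_add_right)
  finally show "(LINT v|restrict_space lborel {p..p + 2 * H}. w v)
      = (LINT v|restrict_space lborel {p..p + H}. w v + w (v + H))"
    by (simp add: integral_restrict_space)
qed

section \<open>Symbols and inner products of even shifts\<close>

text \<open>
  The factor \<open>\<surd>2/2\<close> makes the folded square \<open>|X(v)|\<^sup>2 + |X(v + \<pi>|B|)|\<^sup>2\<close> equal to 1 almost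
  everywhere, and not 2, for a sequence whose even shifts are orthonormal.
\<close>

definition is_symbol :: "real \<Rightarrow> (int \<Rightarrow> complex) \<Rightarrow> (real \<Rightarrow> complex) \<Rightarrow> bool" where
  "is_symbol B x X \<longleftrightarrow> (\<forall>p. l2_has_sum (period_measure B p)
      (\<lambda>n u. complex_of_real (sqrt 2 / 2) * x n * trig B n u) X)"

lemma half_sqrt2: "complex_of_real (sqrt 2 / 2) * complex_of_real (sqrt 2 / 2) = 1 / 2"
  by (simp flip: of_real_mult)

lemma symbol_Parseval:
  assumes B: "B \<noteq> 0" 
    and X: "l2_has_sum (period_measure B p) (\<lambda>n u. complex_of_real (sqrt 2 / 2) * x n * trig B n
        u) X"
    and Y: "l2_has_sum (period_measure B p) (\<lambda>n u. complex_of_real (sqrt 2 / 2) * y n * trig B n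
        u) Y"
  shows "((\<lambda>n. complex_of_real (pi * \<bar>B\<bar>) * (x n * cnj (y n))) has_sum l2_inner
      (period_measure B p) X Y) UNIV"
proof -
  have "complex_of_real (2 * pi * \<bar>B\<bar>) * (complex_of_real (sqrt 2 / 2) * x n * cnj
      (complex_of_real (sqrt 2 / 2) * y n))
    = complex_of_real (pi * \<bar>B\<bar>) * (x n * cnj (y n))" for n
  proof -
    have "complex_of_real (2 * pi * \<bar>B\<bar>) * (complex_of_real (sqrt 2 / 2) * x n * cnj
        (complex_of_real (sqrt 2 / 2) * y n))
      = complex_of_real (2 * pi * \<bar>B\<bar>) * (complex_of_real (sqrt 2 / 2) * complex_of_real
          (sqrt 2 / 2)) * (x n * cnj (y n))"
      by (simp only: complex_cnj_mult complex_cnj_complex_of_real mult_ac)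
    then show ?thesis unfolding half_sqrt2 by simp
  qed
  with l2_Parseval[OF X Y trig_in_l2 trig_orthogonal[OF B]] show ?thesis by (simp only:)
qed

text \<open>
  Both inner products equal the same series in the coefficients, by Parseval in \<open>L\<^sup>2(M)\<close> and in
  \<open>L\<^sup>2\<close> of a period.
\<close>

lemma inner_eq_symbol_inner:
  assumes B: "B \<noteq> 0" and E: "orthonormal M E"
    and f: "l2_has_sum M (\<lambda>n t. x n * E n t) f" and g: "l2_has_sum M (\<lambda>n t. y n * E n t) g"
    and X: "l2_has_sum (period_measure B p) (\<lambda>n u. complex_of_real (sqrt 2 / 2) * x n * trig B n
        u) X"
    and Y: "l2_has_sum (period_measure B p) (\<lambda>n u. complex_of_real (sqrt 2 / 2) * y n * trig B n
        u) Y"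
  shows "l2_inner (period_measure B p) X Y = complex_of_real (pi * \<bar>B\<bar>) * l2_inner M f g"
proof -
  have "((\<lambda>n. 1 * (x n * cnj (y n))) has_sum l2_inner M f g) UNIV"
    by (rule l2_Parseval[OF f g]) (use E in \<open>auto simp: orthonormal_def\<close>)
  then have "((\<lambda>n. complex_of_real (pi * \<bar>B\<bar>) * (x n * cnj (y n))) has_sum complex_of_real
      (pi * \<bar>B\<bar>) * l2_inner M f g) UNIV"
    by (intro has_sum_cmult_right) simp
  with symbol_Parseval[OF B X Y] show ?thesis
    by (rule has_sum_unique)
qed

lemma symbol_mult_trig:
  assumes "is_symbol B x X"
  shows "l2_has_sum (period_measure B p) (\<lambda>n u. complex_of_real (sqrt 2 / 2) * x (n - j) * trig B
      n u) (\<lambda>u. trig B j u * X u)"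
  using l2_has_sum_mult_trig[of _ _ "\<lambda>n. complex_of_real (sqrt 2 / 2) * x n"] assms
      by (simp add: is_symbol_def)

text \<open>
  The entries of \<open>U U\<^sup>\<star>\<close> are functions of this form, up to an affine substitution.
\<close>

definition fold_product :: "real \<Rightarrow> (real \<Rightarrow> complex) \<Rightarrow> (real \<Rightarrow> complex) \<Rightarrow> real \<Rightarrow> complex" where
  "fold_product B X Y v = X v * cnj (Y v) + X (v + pi * \<bar>B\<bar>) * cnj (Y (v + pi * \<bar>B\<bar>))"

lemma symbol_l2: "is_symbol B x X \<Longrightarrow> X \<in> l2_space (period_measure B p)"
  by (auto simp: is_symbol_def l2_has_sum_def)

context
  fixes M :: "'a measure" and E f g :: "int \<Rightarrow> 'a \<Rightarrow> complex" and x y X Y B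
  assumes B: "B \<noteq> 0" and E: "orthonormal M E"
    and f: "\<And>k. l2_has_sum M (\<lambda>n t. x (n - 2 * k) * E n t) (f k)"
    and g: "\<And>k. l2_has_sum M (\<lambda>n t. y (n - 2 * k) * E n t) (g k)"
    and X: "is_symbol B x X" and Y: "is_symbol B y Y"
begin

lemma fold_product_integrable:
  "integrable (restrict_space lborel {p..p + pi * \<bar>B\<bar>}) (fold_product B X Y)"
proof -
  have "integrable (restrict_space lborel {p..p + 2 * (pi * \<bar>B\<bar>)}) (\<lambda>v. X v * cnj (Y v))"
    using integrable_l2_product[OF symbol_l2[OF X] symbol_l2[OF Y]] by (simp add: mult.assoc)
  from integral_fold(1)[OF _ this] show ?thesis
    using B by (simp add: fold_product_def[abs_def])
qed

text \<open>
  The symbols of \<open>f j\<close> and \<open>g k\<close> are \<open>X\<close> and \<open>Y\<close> times the exponentials with indices \<open>2j\<close> and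
  \<open>2k\<close>. Their quotient has period \<open>\<pi>|B|\<close>, so it factors out when the integral over a period is
  folded.
\<close>

lemma fold_product_moment:
  "(LINT v|restrict_space lborel {p..p + pi * \<bar>B\<bar>}. fold_product B X Y v * trig B (2 * (j - k)) v)
    = complex_of_real (pi * \<bar>B\<bar>) * l2_inner M (f j) (g k)"
proof -
  define w where "w = (\<lambda>v. trig B (2 * j) v * X v * cnj (trig B (2 * k) v * Y v))"
  have w: "w v = X v * cnj (Y v) * trig B (2 * (j - k)) v" for v
    using trig_mult[of B "2 * j" v "- 2 * k"]
    by (simp add: w_def cnj_trig algebra_simps)
  have t: "trig B (2 * n) (v + pi * \<bar>B\<bar>) = trig B (2 * n) v" for n v
    by (simp add: trig_add_half_period[OF B] power_int_mult)
  note XY = symbol_mult_trig[OF X, of p "2 * j"] symbol_mult_trig[OF Y, of p "2 * k"]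
  have "l2_inner (period_measure B p) (\<lambda>v. trig B (2 * j) v * X v) (\<lambda>v. trig B (2 * k) v * Y v)
      = complex_of_real (pi * \<bar>B\<bar>) * l2_inner M (f j) (g k)"
    by (rule inner_eq_symbol_inner[OF B E f g XY])
  then have "(LINT v|restrict_space lborel {p..p + 2 * (pi * \<bar>B\<bar>)}. w v)
      = complex_of_real (pi * \<bar>B\<bar>) * l2_inner M (f j) (g k)"
    by (simp add: l2_inner_def w_def mult.assoc)
  moreover have "integrable (restrict_space lborel {p..p + 2 * (pi * \<bar>B\<bar>)}) w"
    using integrable_l2_product[of "\<lambda>v. trig B (2 * j) v * X v" "period_measure B p" "\<lambda>v. trig B
        (2 * k) v * Y v"] XY
    by (simp add: l2_has_sum_def w_def mult.assoc)
  ultimately have "(LINT v|restrict_space lborel {p..p + pi * \<bar>B\<bar>}. w v + w (v + pi * \<bar>B\<bar>))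
      = complex_of_real (pi * \<bar>B\<bar>) * l2_inner M (f j) (g k)"
    using integral_fold(2)[of "pi * \<bar>B\<bar>" p w] B by simp
  then show ?thesis
    unfolding w t fold_product_def by (simp only: distrib_right)
qed

text \<open>
  The inner products depend only on \<open>j - k\<close> and are the Fourier coefficients of the folded
  product over an interval of length \<open>\<pi>|B|\<close>; the prescribed values are the coefficients of the
  constant \<open>\<kappa>\<close>.
\<close>

lemma inner_iff_fold_product:
  "(\<forall>j k. l2_inner M (f j) (g k) = (if j = k then \<kappa> else 0))
    \<longleftrightarrow> (AE v in lborel. fold_product B X Y v = \<kappa>)"
proof
  assume *: "\<forall>j k. l2_inner M (f j) (g k) = (if j = k then \<kappa> else 0)"
  define H where "H = pi * \<bar>B\<bar>"
  have H: "H > 0" using B by (simp add: H_def)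
  have "AE v in lborel. v \<in> {q..<q + H} \<longrightarrow> fold_product B X Y v - \<kappa> = 0" for q
  proof (rule Fourier_uniqueness[OF H])
    interpret finite_measure "restrict_space lborel {q..q + H}" by (rule finite_measure_period)
    have int: "integrable (restrict_space lborel {q..q + H}) (fold_product B X Y)"
      unfolding H_def by (rule fold_product_integrable)
    then show "integrable (restrict_space lborel {q..q + H}) (\<lambda>v. fold_product B X Y v - \<kappa>)"
      by simp
    fix k :: int
    \<comment> \<open>The exponentials run backwards or forwards according to the sign of \<open>B\<close>.\<close>
    define m where "m = (if B > 0 then - k else k)"
    have t: "cis (2 * pi * k * v / H) = trig B (2 * (m - 0)) v" for v
      using B by (auto simp: trig_def H_def m_def field_simps)
    have tm: "trig B n \<in> borel_measurable (restrict_space lborel {q..q + H})" for n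
      using trig_in_l2 by (auto simp: l2_space_def)
    have i1: "integrable (restrict_space lborel {q..q + H})
        (\<lambda>v. fold_product B X Y v * trig B (2 * (m - 0)) v)"
      by (rule integrable_mult_bounded[OF int tm, of _ 1]) simp
    have i2: "integrable (restrict_space lborel {q..q + H}) (\<lambda>v. \<kappa> * trig B (2 * (m - 0)) v)"
      by (rule integrable_mult_bounded[OF _ tm, of _ _ 1]) simp_all
    have "(LINT v|restrict_space lborel {q..q + H}. (fold_product B X Y v - \<kappa>) * cis
        (2 * pi * k * v / H))
      = (LINT v|restrict_space lborel {q..q + H}. fold_product B X Y v * trig B (2 * (m - 0)) v) -
        \<kappa> * (LINT v|restrict_space lborel {q..q + H}. trig B (2 * (m - 0)) v)"
      using i1 i2 by (simp add: t left_diff_distrib)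
    also have "\<dots> = 0"
      unfolding H_def fold_product_moment integral_trig_half_period[OF B] using * by simp
    finally show "(LINT v|restrict_space lborel {q..q + H}. (fold_product B X Y v - \<kappa>) * cis
        (2 * pi * k * v / H)) = 0" .
  qed
  \<comment> \<open>Countably many translates of the fundamental interval cover the line.\<close>
  then have "AE v in lborel. \<forall>i::int. v \<in> {i * H..<i * H + H} \<longrightarrow> fold_product B X Y v - \<kappa> = 0"
    unfolding AE_all_countable by blast
  then show "AE v in lborel. fold_product B X Y v = \<kappa>"
  proof eventually_elim
    case (elim v)
    have "v \<in> {\<lfloor>v / H\<rfloor> * H..<\<lfloor>v / H\<rfloor> * H + H}"
      using H floor_divide_lower[OF H, of v] floor_divide_upper[OF H, of v]
      by (simp add: distrib_right)
    with elim show ?case by (metis eq_iff_diff_eq_0)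
  qed
next
  assume *: "AE v in lborel. fold_product B X Y v = \<kappa>"
  show "\<forall>j k. l2_inner M (f j) (g k) = (if j = k then \<kappa> else 0)"
  proof (intro allI)
    fix j k
    let ?R = "restrict_space lborel {0..0 + pi * \<bar>B\<bar>}"
    have tm: "trig B n \<in> borel_measurable ?R" for n
      using trig_in_l2 by (auto simp: l2_space_def)
    have hm: "fold_product B X Y \<in> borel_measurable ?R"
      using fold_product_integrable by (rule borel_measurable_integrable)
    have "complex_of_real (pi * \<bar>B\<bar>) * l2_inner M (f j) (g k)
      = (LINT v|?R. fold_product B X Y v * trig B (2 * (j - k)) v)"
      by (rule fold_product_moment[symmetric])
    also have "\<dots> = (LINT v|?R. \<kappa> * trig B (2 * (j - k)) v)"
    proof (rule integral_cong_AE)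
      show "AE v in ?R. fold_product B X Y v * trig B (2 * (j - k)) v = \<kappa> * trig B (2 * (j - k)) v"
        using * by (subst AE_restrict_space_iff) (auto elim!: eventually_mono)
    qed (intro borel_measurable_times tm hm borel_measurable_const)+
    also have "\<dots> = complex_of_real (pi * \<bar>B\<bar>) * (if j = k then \<kappa> else 0)"
      using integral_trig_half_period[OF B, of 0 "j - k"] by simp
    finally show "l2_inner M (f j) (g k) = (if j = k then \<kappa> else 0)"
      using B by simp
  qed
qed

end

section \<open>The two-channel wavelet criterion\<close>

text \<open>
  Half the sum and half the difference of the two given series are the series over the even and
  over the odd indices.
\<close>

lemma has_sum_residue_class:
  fixes s :: "int \<Rightarrow> complex"
  assumes "(s has_sum 2) UNIV" "((\<lambda>n. (-1) powi n * s n) has_sum 0) UNIV"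
  shows "((\<lambda>k. s (j - 2 * k)) has_sum 1) UNIV"
proof -
  have "((\<lambda>n. (1/2) * (s n + (-1) powi j * ((-1) powi n * s n))) has_sum (1/2) *
      (2 + (-1) powi j * 0)) UNIV"
    by (intro has_sum_cmult_right has_sum_add assms)
  then have 1: "((\<lambda>n. (1/2) * (s n + (-1) powi j * ((-1) powi n * s n))) has_sum 1) UNIV"
    by simp
  have e: "(1/2) * (s n + (-1) powi j * ((-1) powi n * s n))
      = (if even (j - n) then s n else 0)" for n
    by (auto simp: power_int_minus_left)
  have "((\<lambda>n. if even (j - n) then s n else 0) has_sum 1) UNIV"
    using 1 unfolding e .
  then have "(s has_sum 1) (range (\<lambda>k. j - 2 * k))"
  proof (subst has_sum_cong_neutral[where T = UNIV and g = "\<lambda>n. if even (j - n) then s n else 0"])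
    fix n assume n: "n \<in> UNIV - range (\<lambda>k. j - 2 * k)"
    have "n \<in> range (\<lambda>k. j - 2 * k)" if "even (j - n)"
    proof -
      have "n = j - 2 * ((j - n) div 2)" using that by simp
      then show ?thesis by blast
    qed
    with n show "(if even (j - n) then s n else 0) = 0" by auto
  qed auto
  moreover have "inj (\<lambda>k. j - 2 * k)" by (auto simp: inj_def)
  ultimately show ?thesis by (simp add: has_sum_reindex o_def)
qed

text \<open>
  A one-sided inverse of a square matrix is two-sided.
\<close>

lemma unitary_transpose2:
  fixes a b c d :: complex
  assumes "a * cnj a + b * cnj b = 1" "a * cnj c + b * cnj d = 0" "c * cnj c + d * cnj d = 1"
  shows "a * cnj a + c * cnj c = 1" "a * cnj b + c * cnj d = 0"
proof -
  define U :: "complex^2^2" where "U = vector [vector [a, b], vector [c, d]]"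
  define W :: "complex^2^2" where "W = vector [vector [cnj a, cnj c], vector [cnj b, cnj d]]"
  have "c * cnj a + d * cnj b = 0"
    using arg_cong[OF assms(2), of cnj] by (simp add: mult.commute)
  with assms have "U ** W = mat 1"
    by (simp add: U_def W_def vec_eq_iff forall_2 matrix_matrix_mult_def sum_2 mat_def)
  then have "W ** U = mat 1" by (simp add: matrix_left_right_inverse)
  then have *: "cnj a * a + cnj c * c = 1" "cnj b * a + cnj d * c = 0"
    by (simp_all add: U_def W_def vec_eq_iff forall_2 matrix_matrix_mult_def sum_2 mat_def)
  then show "a * cnj a + c * cnj c = 1" "a * cnj b + c * cnj d = 0"
    by (simp_all add: mult.commute)
qed

text \<open>
  The orthonormality of the columns of \<open>U\<close>, integrated over a period: the first column with itself
  gives the first series; the two columns with each other give the alternating one, because the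
  shift by half a period multiplies the \<open>n\<close>-th coefficient by \<open>(-1)\<^sup>n\<close>.
\<close>

lemma symbol_column_sums:
  assumes B: "B \<noteq> 0" and X: "is_symbol B x X" and Y: "is_symbol B y Y"
    and U: "AE v in lborel. fold_product B X X v = 1 \<and> fold_product B X Y v
        = 0 \<and> fold_product B Y Y v = 1"
  shows "((\<lambda>n. x n * cnj (x n) + y n * cnj (y n)) has_sum 2) UNIV"
    and "((\<lambda>n. (-1) powi n * (x n * cnj (x n) + y n * cnj (y n))) has_sum 0) UNIV"
proof -
  define H where "H = pi * \<bar>B\<bar>"
  have H0: "complex_of_real H \<noteq> 0" using B by (simp add: H_def)
  define p :: real where "p = 0"
  let ?Q = "period_measure B p"
  let ?s = "complex_of_real (sqrt 2 / 2)"
  have col: "AE v in lborel. X v * cnj (X v) + Y v * cnj (Y v) = 1 \<and>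
      X v * cnj (X (v + H)) + Y v * cnj (Y (v + H)) = 0"
    using U unfolding fold_product_def H_def[symmetric]
    by eventually_elim (blast intro: unitary_transpose2)
  have XY: "l2_has_sum ?Q (\<lambda>n u. ?s * x n * trig B n u) X" "l2_has_sum ?Q
      (\<lambda>n u. ?s * y n * trig B n u) Y"
    using X Y by (auto simp: is_symbol_def)
  have shift: "l2_has_sum ?Q (\<lambda>n u. ?s * (z n * (-1) powi n) * trig B n u) (\<lambda>u. Z (u + H))"
    if "is_symbol B z Z" for z Z
    using l2_has_sum_half_period_shift[OF B that[unfolded is_symbol_def, rule_format], of p]
    by (simp only: H_def mult.assoc)
  note XYH = shift[OF X] shift[OF Y]
  have sp: "X \<in> l2_space ?Q" "Y \<in> l2_space ?Q" "(\<lambda>u. X (u + H)) \<in> l2_space ?Q" "(\<lambda>u. Y (u + H)) \<in>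
      l2_space ?Q"
    using XY XYH by (auto simp: l2_has_sum_def)
  have eval: "l2_inner ?Q X X' + l2_inner ?Q Y Y' = (LINT v|?Q. \<kappa>)"
    if sp': "X' \<in> l2_space ?Q" "Y' \<in> l2_space ?Q"
        and ae: "AE v in lborel. X v * cnj (X' v) + Y v * cnj (Y' v) = \<kappa>"
    for X' Y' and \<kappa> :: complex
  proof -
    have i: "integrable ?Q (\<lambda>v. X v * cnj (X' v))" "integrable ?Q (\<lambda>v. Y v * cnj (Y' v))"
      using sp sp' by (auto intro: integrable_l2_product)
    then have "l2_inner ?Q X X' + l2_inner ?Q Y Y'
        = (LINT v|?Q. X v * cnj (X' v) + Y v * cnj (Y' v))"
      by (simp add: l2_inner_def)
    also have "\<dots> = (LINT v|?Q. \<kappa>)"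
    proof (rule integral_cong_AE)
      show "AE v in ?Q. X v * cnj (X' v) + Y v * cnj (Y' v) = \<kappa>"
        using ae by (subst AE_restrict_space_iff) (auto elim!: eventually_mono)
    qed (use i in \<open>auto intro!: borel_measurable_add dest: borel_measurable_integrable\<close>)
    finally show ?thesis .
  qed
  have "((\<lambda>n. complex_of_real H * (x n * cnj (x n)) + complex_of_real H * (y n * cnj (y n))) has_sum
      l2_inner ?Q X X + l2_inner ?Q Y Y) UNIV"
    unfolding H_def by (intro has_sum_add symbol_Parseval B XY)
  also have "l2_inner ?Q X X + l2_inner ?Q Y Y = (LINT v|?Q. (1::complex))"
    by (rule eval) (use sp col in \<open>auto elim!: eventually_mono\<close>)
  also have "\<dots> = complex_of_real H * 2"
    by (simp add: measure_restrict_space scaleR_conv_of_real H_def)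
  finally have "((\<lambda>n. complex_of_real H * (x n * cnj (x n) + y n * cnj (y n))) has_sum
      complex_of_real H * 2) UNIV"
    by (simp only: distrib_left)
  then show "((\<lambda>n. x n * cnj (x n) + y n * cnj (y n)) has_sum 2) UNIV"
    using H0 unfolding has_sum_cmult_right_iff[OF H0] by simp
  have "((\<lambda>n. complex_of_real H * (x n * cnj (x n * (-1) powi n)) + complex_of_real H *
      (y n * cnj (y n * (-1) powi n))) has_sum
      l2_inner ?Q X (\<lambda>u. X (u + H)) + l2_inner ?Q Y (\<lambda>u. Y (u + H))) UNIV"
    unfolding H_def by (intro has_sum_add symbol_Parseval B XY XYH[unfolded H_def])
  also have "l2_inner ?Q X (\<lambda>u. X (u + H)) + l2_inner ?Q Y (\<lambda>u. Y (u + H))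
      = (LINT v|?Q. (0::complex))"
    by (rule eval) (use sp col in \<open>auto elim!: eventually_mono\<close>)
  also have "\<dots> = complex_of_real H * 0"
    by simp
  also have "(\<lambda>n. complex_of_real H * (x n * cnj (x n * (-1) powi n)) + complex_of_real H *
      (y n * cnj (y n * (-1) powi n)))
    = (\<lambda>n. complex_of_real H * ((-1) powi n * (x n * cnj (x n) + y n * cnj (y n))))"
    by (simp add: fun_eq_iff power_int_minus_left algebra_simps)
  finally show "((\<lambda>n. (-1) powi n * (x n * cnj (x n) + y n * cnj (y n))) has_sum 0) UNIV"
    using H0 unfolding has_sum_cmult_right_iff[OF H0] by simp
qed

text \<open>
  The criterion with the chirps removed: the families \<open>f\<close> and \<open>g\<close> enter through two coefficient
  sequences and their even shifts, so the underlying measure space may be arbitrary.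
\<close>

theorem wavelet_basis_iff_symbol:
  fixes M :: "'a measure" and E f g :: "int \<Rightarrow> 'a \<Rightarrow> complex"
  assumes B: "B \<noteq> 0"
    and V0: "l2_closed_subspace M V0" and V1: "l2_closed_subspace M V1" and V01: "V0 \<subseteq> V1"
    and f_basis: "l2_orthonormal_basis M V0 f" and E_basis: "l2_orthonormal_basis M V1 E"
    and f: "\<And>k. l2_has_sum M (\<lambda>n t. x (n - 2 * k) * E n t) (f k)"
    and g: "\<And>k. l2_has_sum M (\<lambda>n t. y (n - 2 * k) * E n t) (g k)"
    and X: "is_symbol B x X" and Y: "is_symbol B y Y"
  shows "l2_orthonormal_basis M (l2_orth_complement M V0 V1) g \<longleftrightarrow>
    (AE v in lborel. fold_product B X X v = 1 \<and> fold_product B X Y v = 0 \<and> fold_product B Y Y v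
        = 1)"
    (is "?L \<longleftrightarrow> ?R")
proof -
  have E: "orthonormal M E" using E_basis V1 by (rule orthonormal_basis_imp_orthonormal)
  have f_on: "orthonormal M f" using f_basis V0 by (rule orthonormal_basis_imp_orthonormal)
  have gs: "g k \<in> l2_space M" and fs: "f k \<in> l2_space M" for k
    using f g by (auto simp: l2_has_sum_def)
  have ff: "AE v in lborel. fold_product B X X v = 1"
    using f_on by (intro inner_iff_fold_product[OF B E f f X X, THEN iffD1])
        (auto simp: orthonormal_def)
  have fg_iff: "(\<forall>j k. l2_inner M (f j) (g k) = 0) \<longleftrightarrow> (AE v in lborel. fold_product B X Y v = 0)"
    using inner_iff_fold_product[OF B E f g X Y, of 0] by simp
  note gg_iff = inner_iff_fold_product[OF B E g g Y Y, of 1]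
  show ?thesis
  proof
    assume L: ?L
    have "l2_inner M (f j) (g k) = 0" for j k
    proof -
      have "f j \<in> V0" "g k \<in> l2_orth_complement M V0 V1"
        using L f_basis by (auto simp: l2_orthonormal_basis_def)
      then have "l2_inner M (g k) (f j) = 0" by (auto simp: l2_orth_complement_def)
      then show ?thesis by (subst l2_inner_commute) simp
    qed
    then have "AE v in lborel. fold_product B X Y v = 0" using fg_iff by blast
    moreover have "AE v in lborel. fold_product B Y Y v = 1"
      using L gg_iff by (simp add: l2_orthonormal_basis_def)
    ultimately show ?R using ff by eventually_elim simp
  next
    assume R: ?R
    have fg: "l2_inner M (f j) (g k) = 0" for j k
      using fg_iff R by (auto elim: eventually_mono)
    have gg: "l2_inner M (g j) (g k) = (if j = k then 1 else 0)" for j k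
      using gg_iff R by (auto elim: eventually_mono)
    have gf: "l2_inner M (g k) (f j) = 0" for j k
      by (subst l2_inner_commute) (simp add: fg)
    have V1': "cfun.subspace V1" "l2_closure M V1 = V1" using V1
        by (auto simp: l2_closed_subspace_def)
    have EV: "E n \<in> V1" for n using E_basis by (simp add: l2_orthonormal_basis_def)
    have gV1: "g k \<in> V1" for k
      using l2_has_sum_in_closure[OF g V1'(1)] cfun_subspaceD(3)[OF V1'(1) EV] V1'(2) by simp
    have fV0: "f k \<in> V0" for k using f_basis by (simp add: l2_orthonormal_basis_def)
    have "V0 \<subseteq> {h \<in> l2_space M. l2_inner M h (g k) = 0}" for k
    proof -
      have "l2_closure M (cfun.span (range f)) \<subseteq> {h \<in> l2_space M. l2_inner M h (g k) = 0}"
        by (rule l2_closure_span_subset[OF l2_closed_orth[OF gs]]) (use fs fg in auto)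
      then show ?thesis using f_basis by (auto simp: l2_orthonormal_basis_def)
    qed
    then have "l2_inner M (g k) h = 0" if "h \<in> V0" for k h
      using that by (subst l2_inner_commute) auto
    then have gW: "g k \<in> l2_orth_complement M V0 V1" for k
      using gV1 by (simp add: l2_orth_complement_def)

    define b where "b = case_sum f g"
    have b_on: "orthonormal M b"
      unfolding orthonormal_def b_def using f_on gs fg gf gg
      by (auto simp: orthonormal_def split: sum.split)
    have range_b: "range b = range f \<union> range g"
      by (auto simp: b_def UNIV_sum image_Un image_image)
    have E_span: "E j \<in> l2_closure M (cfun.span (range b))" for j
    proof (rule l2_has_sum_in_closure[OF orthonormal_expansion[OF b_on]])
      show Es: "E j \<in> l2_space M" using E by (simp add: orthonormal_def)
      have coefficientE: "l2_inner M u (E j) = z j" if "l2_has_sum M (\<lambda>n t. z n * E n t) u" for z u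
        using l2_coefficient[OF that, of 1] E by (simp add: orthonormal_def)
      have cf: "l2_inner M (E j) (f k) = cnj (x (j - 2 * k))" for k
        using coefficientE[OF f] by (subst l2_inner_commute) simp
      have cg: "l2_inner M (E j) (g k) = cnj (y (j - 2 * k))" for k
        using coefficientE[OF g] by (subst l2_inner_commute) simp
      have "((\<lambda>k. x (j - 2 * k) * cnj (x (j - 2 * k)) + y (j - 2 * k) * cnj (y (j - 2 * k)))
          has_sum 1) UNIV"
        using has_sum_residue_class[OF symbol_column_sums[OF B X Y R]] .
      then have "((\<lambda>k. complex_of_real ((cmod (x (j - 2 * k)))\<^sup>2 + (cmod (y (j - 2 * k)))\<^sup>2))
          has_sum complex_of_real 1) UNIV"
        by (simp only: of_real_add complex_norm_square of_real_1)
      then have s: "((\<lambda>k. (cmod (x (j - 2 * k)))\<^sup>2 + (cmod (y (j - 2 * k)))\<^sup>2) has_sum 1) UNIV"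
        by (simp only: has_sum_of_real_iff)
      have sx: "(\<lambda>k. (cmod (x (j - 2 * k)))\<^sup>2) summable_on UNIV"
        and sy: "(\<lambda>k. (cmod (y (j - 2 * k)))\<^sup>2) summable_on UNIV"
        by (rule summable_on_comparison_test[OF has_sum_imp_summable[OF s]]; simp)+
      define p q where "p = (\<Sum>\<^sub>\<infinity>k. (cmod (x (j - 2 * k)))\<^sup>2)" and "q
          = (\<Sum>\<^sub>\<infinity>k. (cmod (y (j - 2 * k)))\<^sup>2)"
      have px: "((\<lambda>k. (cmod (x (j - 2 * k)))\<^sup>2) has_sum p) UNIV"
          and qy: "((\<lambda>k. (cmod (y (j - 2 * k)))\<^sup>2) has_sum q) UNIV"
        unfolding p_def q_def using sx sy by auto
      have pq: "p + q = 1"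
        using has_sum_add[OF px qy] s has_sum_unique by blast
      have "((\<lambda>i. (cmod (l2_inner M (E j) (b i)))\<^sup>2) has_sum (p + q)) (range Inl \<union> range Inr)"
      proof (rule has_sum_Un_disjoint)
        show "((\<lambda>i. (cmod (l2_inner M (E j) (b i)))\<^sup>2) has_sum p) (range Inl)"
          using px by (simp add: has_sum_reindex o_def b_def cf)
        show "((\<lambda>i. (cmod (l2_inner M (E j) (b i)))\<^sup>2) has_sum q) (range Inr)"
          using qy by (simp add: has_sum_reindex o_def b_def cg)
      qed auto
      moreover have "(l2_norm M (E j))\<^sup>2 = 1"
        using l2_inner_self[of M "E j"] E by (simp add: orthonormal_def del: of_real_power)
      ultimately show "((\<lambda>i. (cmod (l2_inner M (E j) (b i)))\<^sup>2) has_sum (l2_norm M (E j))\<^sup>2) UNIV"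
        using pq by (simp add: UNIV_sum)
      show "cfun.subspace (cfun.span (range b))" by (rule cfun.subspace_span)
      show "(\<lambda>t. l2_inner M (E j) (b i) * b i t) \<in> cfun.span (range b)" for i
        by (intro cfun.span_scale cfun.span_base) simp
    qed
    have V1_span: "V1 \<subseteq> l2_closure M (cfun.span (range b))"
    proof -
      have "cfun.span (range E) \<subseteq> l2_closure M (cfun.span (range b))"
        by (rule cfun.span_minimal) (use E_span subspace_l2_closure cfun.subspace_span in auto)
      then have "l2_closure M (cfun.span (range E)) \<subseteq> l2_closure M (cfun.span (range b))"
        using l2_closure_mono l2_closure_idem by blast
      then show ?thesis using E_basis by (auto simp: l2_orthonormal_basis_def)
    qed
    have "l2_orth_complement M V0 V1 \<subseteq> l2_closure M (cfun.span (range g))"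
    proof
      fix h assume h: "h \<in> l2_orth_complement M V0 V1"
      then have hV: "h \<in> V1" and h_orth: "\<And>u. u \<in> V0 \<Longrightarrow> l2_inner M h u = 0"
        by (auto simp: l2_orth_complement_def)
      have hs: "h \<in> l2_space M" using hV V1 by (auto simp: l2_closed_subspace_def)
      show "h \<in> l2_closure M (cfun.span (range g))"
        unfolding l2_closure_def
      proof (intro CollectI conjI allI impI hs)
        fix \<epsilon> :: real assume "\<epsilon> > 0"
        then obtain u where u: "u \<in> cfun.span (range b)" "l2_norm M (\<lambda>t. h t - u t) < \<epsilon>"
          using hV V1_span unfolding l2_closure_def by blast
        then obtain p q where p: "p \<in> cfun.span (range f)" and q: "q \<in> cfun.span (range g)"
            and "u = p + q"
          unfolding range_b cfun.span_Un by blast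
        \<comment> \<open>Since \<open>h - q\<close> is orthogonal to \<open>p\<close>, dropping \<open>p\<close> brings the approximation closer to
          \<open>h\<close>.\<close>
        have pV0: "p \<in> V0"
          using p cfun.span_minimal[of "range f" V0] fV0 V0 by (auto simp: l2_closed_subspace_def)
        have q_sub: "cfun.span (range g) \<subseteq> {u \<in> l2_space M. l2_inner M u p = 0}"
        proof (rule cfun.span_minimal)
          have ps: "p \<in> l2_space M" using pV0 V0 by (auto simp: l2_closed_subspace_def)
          show "cfun.subspace {u \<in> l2_space M. l2_inner M u p = 0}"
              by (rule l2_closed_orth(1)[OF ps])
          show "range g \<subseteq> {u \<in> l2_space M. l2_inner M u p = 0}"
            using gs gW pV0 by (auto simp: l2_orth_complement_def)
        qed
        then have qs: "q \<in> l2_space M" "l2_inner M q p = 0" using q by auto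
        have ps: "p \<in> l2_space M" using pV0 V0 by (auto simp: l2_closed_subspace_def)
        have hq: "(\<lambda>t. h t - q t) \<in> l2_space M" using hs qs by (simp add: l2_space_diff)
        have "l2_inner M (\<lambda>t. h t - q t) p = 0"
          using h_orth[OF pV0] hs qs ps by (simp add: l2_inner_diff_left)
        then have "l2_inner M (\<lambda>t. h t - q t) (\<lambda>t. -1 * p t) = 0"
          by (simp only: l2_inner_scale_right mult_zero_right)
        then have "(l2_norm M (\<lambda>t. (h t - q t) + -1 * p t))\<^sup>2
            = (l2_norm M (\<lambda>t. h t - q t))\<^sup>2 + (l2_norm M (\<lambda>t. -1 * p t))\<^sup>2"
          using l2_norm_add_sq[OF hq l2_space_scale[OF ps, of "-1"]] by simp
        moreover have "(\<lambda>t. (h t - q t) + -1 * p t) = (\<lambda>t. h t - u t)"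
          by (simp add: \<open>u = p + q\<close> fun_eq_iff)
        ultimately have "(l2_norm M (\<lambda>t. h t - q t))\<^sup>2 \<le> (l2_norm M (\<lambda>t. h t - u t))\<^sup>2"
          by simp
        then have "l2_norm M (\<lambda>t. h t - q t) \<le> l2_norm M (\<lambda>t. h t - u t)"
          by (rule power2_le_imp_le) simp
        then show "\<exists>u\<in>cfun.span (range g) \<inter> l2_space M. l2_norm M (\<lambda>t. h t - u t) < \<epsilon>"
          using q qs u(2) by (intro bexI[of _ q]) auto
      qed
    qed
    then show ?L
      using gW gg by (auto simp: l2_orthonormal_basis_def)
  qed
qed

section \<open>Affine substitutions on the real line\<close>

lemma AE_lborel_affine_imp:
  fixes P :: "real \<Rightarrow> bool"
  assumes s: "s \<noteq> 0" and P: "AE v in lborel. P v"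
  shows "AE u in lborel. P (r + s * u)"
proof -
  obtain N where N: "{v. \<not> P v} \<subseteq> N" "N \<in> sets lborel" "emeasure lborel N = 0"
    using AE_E[OF P] by auto
  have "AE v in lborel. v \<notin> N"
    using N by (subst AE_iff_measurable[of N]) auto
  moreover have "Measurable.pred borel (\<lambda>v. v \<notin> N)"
    using N(2) by simp
  ultimately have "AE u in lborel. r + s * u \<notin> N"
    by (intro AE_borel_affine[OF s])
  then show ?thesis
    by eventually_elim (use N(1) in auto)
qed

text \<open>
  The substitution maps null sets to null sets, in both directions.
\<close>

lemma AE_lborel_affine_iff:
  fixes P :: "real \<Rightarrow> bool"
  assumes "s \<noteq> 0"
  shows "(AE u in lborel. P (r + s * u)) \<longleftrightarrow> (AE v in lborel. P v)"
proof
  assume "AE u in lborel. P (r + s * u)"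
  then have "AE v in lborel. P (r + s * (- r / s + 1 / s * v))"
    using assms by (intro AE_lborel_affine_imp[of "1 / s" "\<lambda>u. P (r + s * u)" "- r / s"]) simp_all
  moreover have "r + s * (- r / s + 1 / s * v) = v" for v
    using assms by (simp add: field_simps)
  ultimately show "AE v in lborel. P v"
    by (simp only:)
qed (rule AE_lborel_affine_imp[OF assms])

lemma l2_affine:
  assumes s: "s \<noteq> 0" and w: "w \<in> borel_measurable borel" "\<And>t. cmod (w t) = 1"
    and f: "f \<in> l2_space lborel"
  shows "(\<lambda>t. w t * f (r + s * t)) \<in> l2_space lborel"
    and "l2_norm lborel (\<lambda>t. w t * f (r + s * t)) = 1 / sqrt \<bar>s\<bar> * l2_norm lborel f"
proof -
  have [measurable]: "f \<in> borel_measurable borel" and i: "integrable lborel (\<lambda>t. (cmod (f t))\<^sup>2)"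
    using f by (auto simp: l2_space_def)
  note [measurable] = w(1)
  have n: "(cmod (w t * f (r + s * t)))\<^sup>2 = (cmod (f (r + s * t)))\<^sup>2" for t
    by (simp add: norm_mult w)
  show "(\<lambda>t. w t * f (r + s * t)) \<in> l2_space lborel"
    unfolding l2_space_def mem_Collect_eq n
    using lborel_integrable_real_affine[OF i s, of r] by simp
  have "(LINT t|lborel. (cmod (f t))\<^sup>2) = \<bar>s\<bar> * (LINT t|lborel. (cmod (f (r + s * t)))\<^sup>2)"
    using lborel_integral_real_affine[OF s, of "\<lambda>t. (cmod (f t))\<^sup>2" r] by simp
  then show "l2_norm lborel (\<lambda>t. w t * f (r + s * t)) = 1 / sqrt \<bar>s\<bar> * l2_norm lborel f"
    unfolding l2_norm_def n using s by (simp add: real_sqrt_mult)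
qed

lemma l2_inner_affine:
  fixes f g :: "real \<Rightarrow> complex" and r s :: real
  assumes s: "s \<noteq> 0" and w: "\<And>t. cmod (w t) = 1"
  shows "l2_inner lborel (\<lambda>t. w t * f (r + s * t)) (\<lambda>t. w t * g (r + s * t))
      = l2_inner lborel f g / \<bar>s\<bar>"
proof -
  have "w t * cnj (w t) = 1" for t
    using complex_norm_square[of "w t"] w by simp
  then have n: "w t * u * cnj (w t * v) = u * cnj v" for t u v
    by (metis (no_types, lifting) complex_cnj_mult mult.commute mult.left_commute
        mult.right_neutral)
  show ?thesis
    unfolding l2_inner_def n
    using lborel_integral_real_affine[OF s, of "\<lambda>t. f t * cnj (g t)" r] s
        by (simp add: scaleR_conv_of_real)
qed

lemma l2_has_sum_affine:
  fixes f :: "real \<Rightarrow> complex" and r s :: real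
  assumes "l2_has_sum lborel g f" "s \<noteq> 0" "w \<in> borel_measurable borel" "\<And>t. cmod (w t) = 1"
  shows "l2_has_sum lborel (\<lambda>n t. w t * g n (r + s * t)) (\<lambda>t. w t * f (r + s * t))"
  by (rule l2_has_sum_transform[OF assms(1)]) (rule l2_affine[OF assms(2-4)]; assumption)+

section \<open>Chirped translates and dilates\<close>

definition chirp_translate :: "real \<Rightarrow> (real \<Rightarrow> complex) \<Rightarrow> int \<Rightarrow> real \<Rightarrow> complex" where
  "chirp_translate a \<Phi> k t = cis (- (a * t\<^sup>2 / 2)) * \<Phi> (t - k)"

definition chirp_dilate :: "real \<Rightarrow> (real \<Rightarrow> complex) \<Rightarrow> int \<Rightarrow> real \<Rightarrow> complex" where
  "chirp_dilate a \<Phi> n t = cis (- (a * t\<^sup>2 / 2)) * (complex_of_real (sqrt 2) * \<Phi> (2 * t - n))"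

lemma cis_measurable [measurable]:
  "f \<in> borel_measurable borel \<Longrightarrow> (\<lambda>t. cis (f t)) \<in> borel_measurable borel"
  unfolding cis_conv_exp by measurable

text \<open>
  Up to the factor \<open>\<surd>2\<close> the operator \<open>D\<close> in the scaling property is an isometry of \<open>L\<^sup>2\<close> onto
  itself. It carries \<open>V0\<close> onto \<open>V1\<close>, and the translates to the dilates, so it carries a basis to a
  basis.
\<close>

lemma chirp_dilate_basis:
  assumes V0: "l2_closed_subspace lborel V0" and V1: "l2_closed_subspace lborel V1"
    and dil: "\<And>f. f \<in> l2_space lborel \<Longrightarrow> f \<in> V0
        \<longleftrightarrow> (\<lambda>t. f (2 * t) * cis (a / 2 * ((2 * t)\<^sup>2 - t\<^sup>2))) \<in> V1"
    and basis: "l2_orthonormal_basis lborel V0 (chirp_translate a \<Phi>)"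
  shows "l2_orthonormal_basis lborel V1 (chirp_dilate a \<Phi>)"
proof -
  define w where "w t = cis (a / 2 * ((2 * t)\<^sup>2 - t\<^sup>2))" for t
  define D where "D f t = w t * f (0 + 2 * t)" for f t
  have w: "w \<in> borel_measurable borel" "cmod (w t) = 1" for t
    unfolding w_def by simp_all
  have dil: "f \<in> V0 \<longleftrightarrow> D f \<in> V1" if "f \<in> l2_space lborel" for f
  proof -
    have "D f = (\<lambda>t. f (2 * t) * cis (a / 2 * ((2 * t)\<^sup>2 - t\<^sup>2)))"
      by (rule ext) (simp add: D_def w_def)
    then show ?thesis using dil[OF that] by (simp only:)
  qed
  have V1': "cfun.subspace V1" using V1 by (simp add: l2_closed_subspace_def)
  have F0: "chirp_translate a \<Phi> n \<in> V0" for n using basis by (simp add: l2_orthonormal_basis_def)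
  have Fs: "chirp_translate a \<Phi> n \<in> l2_space lborel" for n
    using F0 V0 by (auto simp: l2_closed_subspace_def)
  have D_F: "chirp_dilate a \<Phi> n = (\<lambda>t. complex_of_real (sqrt 2) * D (chirp_translate a \<Phi> n) t)"
      for n
  proof
    fix t
    have "cis (- (a * t\<^sup>2 / 2)) = w t * cis (- (a * (2 * t)\<^sup>2 / 2))"
      by (simp add: w_def cis_mult algebra_simps)
    then show "chirp_dilate a \<Phi> n t = complex_of_real (sqrt 2) * D (chirp_translate a \<Phi> n) t"
      by (simp add: chirp_dilate_def chirp_translate_def D_def)
  qed
  have "chirp_dilate a \<Phi> n \<in> V1" for n
    unfolding D_F using dil[OF Fs] F0 cfun_subspaceD(3)[OF V1'] by blast
  moreover have "l2_inner lborel (chirp_dilate a \<Phi> m) (chirp_dilate a \<Phi> n)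
      = (if m = n then 1 else 0)" for m n
  proof -
    have "l2_inner lborel (D (chirp_translate a \<Phi> m)) (D (chirp_translate a \<Phi> n))
        = l2_inner lborel (chirp_translate a \<Phi> m) (chirp_translate a \<Phi> n) / \<bar>2::real\<bar>"
      unfolding D_def by (rule l2_inner_affine[OF _ w(2)]) simp
    then have "l2_inner lborel (chirp_dilate a \<Phi> m) (chirp_dilate a \<Phi> n)
        = complex_of_real (sqrt 2 * sqrt 2) * l2_inner lborel (chirp_translate a \<Phi> m)
            (chirp_translate a \<Phi> n) / 2"
      unfolding D_F l2_inner_scale_left l2_inner_scale_right
      by (simp only: of_real_mult mult.assoc complex_cnj_complex_of_real) simp
    then show ?thesis
      using basis by (simp add: l2_orthonormal_basis_def)
  qed
  moreover have "V1 \<subseteq> l2_closure lborel (cfun.span (range (chirp_dilate a \<Phi>)))"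
  proof
    fix h assume h: "h \<in> V1"
    then have hs: "h \<in> l2_space lborel" using V1 by (auto simp: l2_closed_subspace_def)
    define f where "f t = cnj (w (t / 2)) * h (0 + (1 / 2) * t)" for t
    have "(\<lambda>t. cnj (w (t / 2))) = (\<lambda>t. cis (- (a / 2 * ((2 * (t / 2))\<^sup>2 - (t / 2)\<^sup>2))))"
      by (simp add: w_def cis_cnj fun_eq_iff)
    then have "(\<lambda>t. cnj (w (t / 2))) \<in> borel_measurable borel"
      by simp
    then have fs: "f \<in> l2_space lborel"
      unfolding f_def by (intro l2_affine(1) hs) (simp_all add: w)
    have "w t * cnj (w t) = 1" for t
      using complex_norm_square[of "w t"] w(2)[of t] by simp
    then have Df: "D f = h"
      by (simp add: D_def f_def fun_eq_iff flip: mult.assoc)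
    then have "f \<in> V0" using dil[OF fs] h by simp
    then have fc: "f \<in> l2_closure lborel (cfun.span (range (chirp_translate a \<Phi>)))"
      using basis by (auto simp: l2_orthonormal_basis_def)
    show "h \<in> l2_closure lborel (cfun.span (range (chirp_dilate a \<Phi>)))"
      unfolding l2_closure_def
    proof (intro CollectI conjI allI impI hs)
      fix \<epsilon> :: real assume "\<epsilon> > 0"
      then obtain g where g: "g \<in> cfun.span (range (chirp_translate a \<Phi>))" "g \<in> l2_space lborel"
          "l2_norm lborel (\<lambda>t. f t - g t) < \<epsilon>"
        using fc unfolding l2_closure_def by blast
      have "cfun.span (range (chirp_translate a \<Phi>)) \<subseteq>
          {g. D g \<in> cfun.span (range (chirp_dilate a \<Phi>))}"
      proof (rule cfun.span_minimal)
        note span = cfun_subspaceD[OF cfun.subspace_span[of "range (chirp_dilate a \<Phi>)"]]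
        have "D (chirp_translate a \<Phi> n) \<in> cfun.span (range (chirp_dilate a \<Phi>))" for n
        proof -
          have "(\<lambda>t. complex_of_real (1 / sqrt 2) * chirp_dilate a \<Phi> n t) \<in> cfun.span
              (range (chirp_dilate a \<Phi>))"
            by (intro span(3) cfun.span_base) simp
          then show ?thesis by (simp add: D_F)
        qed
        then show "range (chirp_translate a \<Phi>) \<subseteq> {g. D g \<in> cfun.span (range (chirp_dilate a \<Phi>))}"
          by blast
        show "cfun.subspace {g. D g \<in> cfun.span (range (chirp_dilate a \<Phi>))}"
        proof (rule cfun_subspaceI; unfold mem_Collect_eq)
          show "D (\<lambda>t. 0) \<in> cfun.span (range (chirp_dilate a \<Phi>))"
            using span(1) by (simp add: D_def[abs_def])
          show "D (\<lambda>t. u t + v t) \<in> cfun.span (range (chirp_dilate a \<Phi>))"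
            if "D u \<in> cfun.span (range (chirp_dilate a \<Phi>))" "D v \<in> cfun.span
                (range (chirp_dilate a \<Phi>))" for u v
            using span(2)[OF that] by (simp add: D_def[abs_def] distrib_left)
          show "D (\<lambda>t. c * u t) \<in> cfun.span (range (chirp_dilate a \<Phi>))"
            if "D u \<in> cfun.span (range (chirp_dilate a \<Phi>))" for c u
            using span(3)[OF that, of c] by (simp add: D_def[abs_def] mult.left_commute)
        qed
      qed
      then have Dg: "D g \<in> cfun.span (range (chirp_dilate a \<Phi>))" using g(1) by blast
      have Dgs: "D g \<in> l2_space lborel"
        unfolding D_def by (rule l2_affine(1)[OF _ w g(2)]) simp
      have "l2_norm lborel (\<lambda>t. h t - D g t) = l2_norm lborel (D (\<lambda>t. f t - g t))"
        unfolding Df[symmetric] by (simp add: D_def[abs_def] right_diff_distrib)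
      also have "\<dots> = 1 / sqrt \<bar>2\<bar> * l2_norm lborel (\<lambda>t. f t - g t)"
        unfolding D_def by (rule l2_affine(2)[OF _ w l2_space_diff[OF fs g(2)]]) simp
      also have "\<dots> \<le> 1 * l2_norm lborel (\<lambda>t. f t - g t)"
        by (intro mult_right_mono) auto
      also have "\<dots> < \<epsilon>" using g(3) by simp
      finally show "\<exists>g\<in>cfun.span (range (chirp_dilate a \<Phi>)) \<inter> l2_space lborel. l2_norm lborel
          (\<lambda>t. h t - g t) < \<epsilon>"
        using Dg Dgs by blast
    qed
  qed
  ultimately show ?thesis by (simp add: l2_orthonormal_basis_def)
qed

text \<open>
  Translation by \<open>k\<close>, corrected by the quotient of the two chirps, carries \<open>chirp_translate a \<Psi> 0\<close>
  to \<open>chirp_translate a \<Psi> k\<close> and moves the index of the dilates by \<open>2k\<close>.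
\<close>

lemma chirp_translate_expansion:
  assumes "l2_has_sum lborel (\<lambda>n t. x n * chirp_dilate a \<Phi> n t) (chirp_translate a \<Psi> 0)"
  shows "l2_has_sum lborel (\<lambda>n t. x (n - 2 * k) * chirp_dilate a \<Phi> n t) (chirp_translate a \<Psi> k)"
proof -
  define w where "w t = cis (a * (- real_of_int k + 1 * t)\<^sup>2 / 2 - a * t\<^sup>2 / 2)" for t
  have "l2_has_sum lborel (\<lambda>n t. w t * (x n * chirp_dilate a \<Phi> n (- real_of_int k + 1 * t)))
      (\<lambda>t. w t * chirp_translate a \<Psi> 0 (- real_of_int k + 1 * t))"
    by (rule l2_has_sum_affine[OF assms]) (simp_all add: w_def)
  moreover have "w t * (x n * chirp_dilate a \<Phi> n (- real_of_int k + 1 * t))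
      = x n * chirp_dilate a \<Phi> (n + 2 * k) t" for n t
  proof -
    have "w t * cis (- (a * (- real_of_int k + 1 * t)\<^sup>2 / 2)) = cis (- (a * t\<^sup>2 / 2))"
      by (simp add: w_def cis_mult)
    moreover have "2 * (- real_of_int k + 1 * t) - real_of_int n
        = 2 * t - real_of_int (n + 2 * k)" by simp
    moreover have "w t * (x n * (u * v)) = x n * ((w t * u) * v)" for u v
      by (simp only: mult_ac)
    ultimately show ?thesis
      unfolding chirp_dilate_def by (simp only:)
  qed
  moreover have "w t * chirp_translate a \<Psi> 0 (- real_of_int k + 1 * t)
      = chirp_translate a \<Psi> k t" for t
  proof -
    have "w t * cis (- (a * (- real_of_int k + 1 * t)\<^sup>2 / 2)) = cis (- (a * t\<^sup>2 / 2))"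
      by (simp add: w_def cis_mult)
    then show ?thesis
      unfolding chirp_translate_def by (simp flip: mult.assoc)
  qed
  ultimately have "l2_has_sum lborel (\<lambda>n t. x n * chirp_dilate a \<Phi> (n + 2 * k) t)
      (chirp_translate a \<Psi> k)"
    by (simp only:)
  moreover have "bij (\<lambda>n::int. n - 2 * k)"
    by (rule bij_betw_byWitness[where f' = "\<lambda>n. n + 2 * k"]) auto
  ultimately show ?thesis
    using l2_has_sum_reindex by fastforce
qed

lemma exp_half_i: "exp (\<i> / 2 * complex_of_real r)
    = cis (r / 2)" "exp (- (\<i> / 2) * complex_of_real r) = cis (- (r / 2))"
  by (simp_all add: cis_conv_exp)

lemma matrix_unitary2_iff:
  fixes a b c d :: complex
  defines "U \<equiv> (vector [vector [a, b], vector [c, d]] :: complex^2^2)"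
  shows "U ** conj_transpose U = mat 1 \<longleftrightarrow>
    a * cnj a + b * cnj b = 1 \<and> a * cnj c + b * cnj d = 0 \<and> c * cnj c + d * cnj d = 1"
proof -
  have "U ** conj_transpose U = mat 1 \<longleftrightarrow>
    a * cnj a + b * cnj b = 1 \<and> a * cnj c + b * cnj d = 0 \<and> c * cnj a + d * cnj b
        = 0 \<and> c * cnj c + d * cnj d = 1"
    by (simp add: U_def conj_transpose_def vec_eq_iff forall_2 matrix_matrix_mult_def sum_2 mat_def)
  moreover have "c * cnj a + d * cnj b = 0" if "a * cnj c + b * cnj d = 0"
    using arg_cong[OF that, of cnj] by (simp add: mult.commute)
  ultimately show ?thesis by auto
qed

text \<open>
  The argument of the second column exceeds that of the first by \<open>\<plusminus>\<pi>|B2|\<close>, with the sign of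
  \<open>B2/B1\<close>. For the negative sign the columns change places after a shift by \<open>\<pi>|B2|\<close>, which does
  not affect \<open>U U\<^sup>\<star>\<close>.
\<close>

lemma lcst_U_unitary_iff:
  assumes B1: "M1 $ 1 $ 2 \<noteq> 0" and B2: "M2 $ 1 $ 2 \<noteq> 0"
  shows "(AE u in lborel. lcst_U M1 M2 \<Lambda> \<Gamma> u ** conj_transpose (lcst_U M1 M2 \<Lambda> \<Gamma> u) = mat 1) \<longleftrightarrow>
    (AE v in lborel. fold_product (M2 $ 1 $ 2) \<Lambda> \<Lambda> v = 1 \<and> fold_product (M2 $ 1 $ 2) \<Lambda> \<Gamma> v = 0 \<and>
       fold_product (M2 $ 1 $ 2) \<Gamma> \<Gamma> v = 1)" (is "_ \<longleftrightarrow> (AE v in lborel. ?P v)")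
proof -
  define B1 B2 where "B1 = M1 $ 1 $ 2" and "B2 = M2 $ 1 $ 2"
  have nz: "B1 \<noteq> 0" "B2 \<noteq> 0" using assms by (simp_all add: B1_def B2_def)
  define s where "s = B2 / B1"
  define r where "r = (if s > 0 then 0 else - (pi * \<bar>B2\<bar>))"
  have U: "lcst_U M1 M2 \<Lambda> \<Gamma> u ** conj_transpose (lcst_U M1 M2 \<Lambda> \<Gamma> u) = mat 1 \<longleftrightarrow> ?P (r + s * u)" for u
  proof (cases "s > 0")
    case True
    then have "B2 / B1 * (u + pi * \<bar>B1\<bar>) = B2 * u / B1 + pi * \<bar>B2\<bar>"
      using nz by (auto simp: s_def field_simps zero_less_divide_iff)
    then show ?thesis
      using True unfolding lcst_U_def Let_def matrix_unitary2_iff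
      by (simp add: fold_product_def r_def s_def B1_def B2_def)
  next
    case False
    then have "B2 / B1 * (u + pi * \<bar>B1\<bar>) = B2 * u / B1 - pi * \<bar>B2\<bar>"
      using nz by (auto simp: s_def field_simps zero_less_divide_iff)
    then show ?thesis
      using False unfolding lcst_U_def Let_def matrix_unitary2_iff
      by (simp add: fold_product_def r_def s_def B1_def B2_def add.commute)
  qed
  have "s \<noteq> 0" using nz by (simp add: s_def)
  then show ?thesis
    unfolding U by (rule AE_lborel_affine_iff)
qed

lemma lcst_symbol_is_symbol:
  assumes "lcst_symbol M1 M2 z F"
  shows "is_symbol (M2 $ 1 $ 2)
    (\<lambda>n. z n * cis (n\<^sup>2 * (M1 $ 1 $ 1 / M1 $ 1 $ 2) / 8 + 2 * n / M1 $ 1 $ 2)) F"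
proof -
  have "complex_of_real (sqrt 2 / 2) * z n *
      exp ((\<i> / 2) * complex_of_real (n\<^sup>2 * A1 / (4 * B1) + 4 * n / B1 - 2 * n * u / B2))
    = complex_of_real (sqrt 2 / 2) * (z n * cis (n\<^sup>2 * (A1 / B1) / 8 + 2 * n / B1)) * trig B2 n u"
    for n :: int and u A1 B1 B2 :: real
  proof -
    have "(n\<^sup>2 * A1 / (4 * B1) + 4 * n / B1 - 2 * n * u / B2) / 2
        = (n\<^sup>2 * (A1 / B1) / 8 + 2 * n / B1) + - (n * u / B2)"
      by (simp add: add_divide_distrib diff_divide_distrib)
    then show ?thesis
      unfolding exp_half_i trig_def by (simp only: cis_mult[symmetric] mult.assoc)
  qed
  with assms show ?thesis
    by (simp only: lcst_symbol_def is_symbol_def Let_def simp_thms)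
qed

theorem theorem4p4:
  fixes M1 M2 :: "real^2^2"
    and V :: "int \<Rightarrow> (real \<Rightarrow> complex) set"
    and \<phi> \<psi> \<Lambda> \<Gamma> :: "real \<Rightarrow> complex"
    and c d :: "int \<Rightarrow> complex"
  assumes "det M1 = 1" and "M1 $ 1 $ 2 \<noteq> 0"
    and "det M2 = 1" and "M2 $ 1 $ 2 \<noteq> 0"
    and "lcst_orthogonal_MRA M1 M2 V"
    and "lcst_scaling_function M1 M2 V \<phi>"
    and "is_l2_seq c"
    and "l2_has_sum lborel (\<lambda>n t. c n * lcst_family M1 M2 \<phi> 1 n t) (lcst_family M1 M2 \<phi> 0 0)"
    and "is_l2_seq d"
    and "lcst_wavelet_series M1 M2 \<phi> d \<psi>"
    and "lcst_symbol M1 M2 c \<Lambda>"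
    and "lcst_symbol M1 M2 d \<Gamma>"
  shows "l2_orthonormal_basis lborel (l2_orth_complement lborel (V 0) (V 1)) (lcst_family M1 M2 \<psi> 0)
     \<longleftrightarrow> (AE u in lborel. lcst_U M1 M2 \<Lambda> \<Gamma> u ** conj_transpose (lcst_U M1 M2 \<Lambda> \<Gamma> u) = mat 1)"
proof -
  define A1 B1 A2 B2 where "A1 = M1 $ 1 $ 1" and "B1 = M1 $ 1 $ 2" and "A2 = M2 $ 1 $ 1" and "B2
      = M2 $ 1 $ 2"
  note entries = A1_def[symmetric] B1_def[symmetric] A2_def[symmetric] B2_def[symmetric]
  define a where "a = A1 / B1"
  define strip where "strip \<theta> t = \<theta> t * cis (t\<^sup>2 * (A2 / B2) / 2 + t / B1)" for \<theta> :: "real \<Rightarrow>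
      complex" and t
  \<comment> \<open>The constants of modulus 1 by which the LCST families differ from chirped translates and
    dilates.\<close>
  define \<omega> where "\<omega> n = cis (n\<^sup>2 * a / 2 + 2 * n / B1)" for n :: int
  define \<eta> where "\<eta> n = cis (n\<^sup>2 * a / 8 + 2 * n / B1)" for n :: int
  have family0: "lcst_family M1 M2 \<theta> 0 n t = \<omega> n * chirp_translate a (strip \<theta>) n t" for \<theta> n t
  proof -
    have "- (((t\<^sup>2 - (n / 2 powi 0)\<^sup>2) * (A1 / B1) - (2 powi 0 * t - n)\<^sup>2 * (A2 / B2) - 2 *
        (2 powi 0 * t + n) / B1) / 2)
      = (n\<^sup>2 * a / 2 + 2 * n / B1) + (- (a * t\<^sup>2 / 2) + ((t - n)\<^sup>2 * (A2 / B2) / 2 + (t - n) / B1))"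
      by (simp add: a_def add_divide_distrib diff_divide_distrib left_diff_distrib)
    note phase = arg_cong[OF this, of cis, folded cis_mult[of "n\<^sup>2 * a / 2 + 2 * n / B1"]
        cis_mult[of "- (a * t\<^sup>2 / 2)"]]
    show ?thesis
      unfolding lcst_family_def Let_def entries exp_half_i chirp_translate_def strip_def \<omega>_def phase
      by simp
  qed
  have family1: "lcst_family M1 M2 \<phi> 1 n t = \<eta> n * chirp_dilate a (strip \<phi>) n t" for n t
  proof -
    have "- (((t\<^sup>2 - (n / 2 powi 1)\<^sup>2) * (A1 / B1) - (2 powi 1 * t - n)\<^sup>2 * (A2 / B2) - 2 *
        (2 powi 1 * t + n) / B1) / 2)
      = (n\<^sup>2 * a / 8 + 2 * n / B1) + (- (a * t\<^sup>2 / 2) +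
          ((2 * t - n)\<^sup>2 * (A2 / B2) / 2 + (2 * t - n) / B1))"
      by (simp add: a_def add_divide_distrib diff_divide_distrib left_diff_distrib
          right_diff_distrib power_divide mult_ac)
    note phase = arg_cong[OF this, of cis, folded cis_mult[of "n\<^sup>2 * a / 8 + 2 * n / B1"]
        cis_mult[of "- (a * t\<^sup>2 / 2)"]]
    show ?thesis
      unfolding lcst_family_def Let_def entries exp_half_i chirp_dilate_def strip_def \<eta>_def phase
      by (simp add: powr_half_sqrt)
  qed
  define x where "x n = c n * \<eta> n" for n
  define y where "y n = d n * \<eta> n" for n

  have MRA: "\<And>m. l2_closed_subspace lborel (V m)" "\<And>m. V m \<subseteq> V (m + 1)"
    and dil: "\<And>f m. f \<in> l2_space lborel \<Longrightarrow> f \<in> V m \<longleftrightarrow>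
         (\<lambda>t. f (2 * t) * exp (\<i> * complex_of_real (A1 / (2 * B1) * ((2 * t)\<^sup>2 - t\<^sup>2)))) \<in> V
             (m + 1)"
    using assms(5) unfolding lcst_orthogonal_MRA_def Let_def entries by blast+
  have V0: "l2_closed_subspace lborel (V 0)" and V1: "l2_closed_subspace lborel (V 1)"
      and V01: "V 0 \<subseteq> V 1"
    using MRA(1) MRA(2)[of 0] by simp_all
  have f_basis: "l2_orthonormal_basis lborel (V 0) (chirp_translate a (strip \<phi>))"
  proof -
    have "lcst_family M1 M2 \<phi> 0 = (\<lambda>n t. \<omega> n * chirp_translate a (strip \<phi>) n t)"
      by (intro ext family0)
    then have "l2_orthonormal_basis lborel (V 0) (\<lambda>n t. \<omega> n * chirp_translate a (strip \<phi>) n t)"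
      using assms(6) by (simp only: lcst_scaling_function_def)
    then show ?thesis
      by (subst (asm) orthonormal_basis_unimodular_iff)
         (use V0 in \<open>simp_all add: l2_closed_subspace_def \<omega>_def\<close>)
  qed
  have E_basis: "l2_orthonormal_basis lborel (V 1) (chirp_dilate a (strip \<phi>))"
  proof (rule chirp_dilate_basis[OF V0 V1 _ f_basis])
    fix f :: "real \<Rightarrow> complex" assume "f \<in> l2_space lborel"
    from dil[OF this, of 0]
    show "f \<in> V 0 \<longleftrightarrow> (\<lambda>t. f (2 * t) * cis (a / 2 * ((2 * t)\<^sup>2 - t\<^sup>2))) \<in> V 1"
      by (simp add: a_def cis_conv_exp mult.commute[of 2 B1])
  qed
  have f: "l2_has_sum lborel (\<lambda>n t. x (n - 2 * k) * chirp_dilate a (strip \<phi>) n t)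
      (chirp_translate a (strip \<phi>) k)" for k
  proof (rule chirp_translate_expansion)
    have "lcst_family M1 M2 \<phi> 0 0 = chirp_translate a (strip \<phi>) 0"
      by (rule ext) (simp add: family0 \<omega>_def)
    moreover have "c n * lcst_family M1 M2 \<phi> 1 n t = x n * chirp_dilate a (strip \<phi>) n t" for n t
      by (simp only: family1 x_def mult.assoc)
    ultimately show "l2_has_sum lborel (\<lambda>n t. x n * chirp_dilate a (strip \<phi>) n t)
        (chirp_translate a (strip \<phi>) 0)"
      using assms(8) by (simp only:)
  qed
  have g: "l2_has_sum lborel (\<lambda>n t. y (n - 2 * k) * chirp_dilate a (strip \<phi>) n t)
      (chirp_translate a (strip \<psi>) k)" for k
  proof (rule chirp_translate_expansion)
    \<comment> \<open>Multiplying the defining series of \<open>\<psi>\<close> by \<open>w\<close> completes the square in its phase: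
      \<open>3t\<^sup>2 - 4tn + n\<^sup>2 + t\<^sup>2 = (2t - n)\<^sup>2\<close>.\<close>
    define w where "w t = cis (- (a * t\<^sup>2 / 2) + (t\<^sup>2 * (A2 / B2) / 2 + t / B1))" for t :: real
    note series = assms(10)[unfolded lcst_wavelet_series_def Let_def entries]
    have "l2_has_sum lborel
        (\<lambda>(n::int) t. w t * (d n * complex_of_real (sqrt 2) * \<phi> (2 * (0 + 1 * t) - n) *
           exp ((\<i> / 2) * complex_of_real
             (n\<^sup>2 * A1 / (4 * B1) + (3 * (0 + 1 * t)\<^sup>2 - 4 * (0 + 1 * t) * n + n\<^sup>2) * (A2 / B2) +
                 2 * ((0 + 1 * t) + n) / B1))))
        (\<lambda>t. w t * \<psi> (0 + 1 * t))"
      by (rule l2_has_sum_affine[OF series]) (simp_all add: w_def)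
    moreover have "w t * (d n * complex_of_real (sqrt 2) * \<phi> (2 * (0 + 1 * t) - n) *
           exp ((\<i> / 2) * complex_of_real
             (n\<^sup>2 * A1 / (4 * B1) + (3 * (0 + 1 * t)\<^sup>2 - 4 * (0 + 1 * t) * n + n\<^sup>2) * (A2 / B2) +
                 2 * ((0 + 1 * t) + n) / B1)))
        = y n * chirp_dilate a (strip \<phi>) n t" for n :: int and t :: real
    proof -
      have "(- (a * t\<^sup>2 / 2) + (t\<^sup>2 * (A2 / B2) / 2 + t / B1)) +
          (n\<^sup>2 * A1 / (4 * B1) + (3 * (0 + 1 * t)\<^sup>2 - 4 * (0 + 1 * t) * n + n\<^sup>2) * (A2 / B2) + 2
              * ((0 + 1 * t) + n) / B1) / 2
        = (n\<^sup>2 * a / 8 + 2 * n / B1) + (- (a * t\<^sup>2 / 2) +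
            ((2 * t - n)\<^sup>2 * (A2 / B2) / 2 + (2 * t - n) / B1))"
        by (simp add: a_def add_divide_distrib diff_divide_distrib power2_eq_square algebra_simps)
      then have e: "w t * exp ((\<i> / 2) * complex_of_real
          (n\<^sup>2 * A1 / (4 * B1) + (3 * (0 + 1 * t)\<^sup>2 - 4 * (0 + 1 * t) * n + n\<^sup>2) * (A2 / B2) + 2
              * ((0 + 1 * t) + n) / B1))
        = \<eta> n * (cis (- (a * t\<^sup>2 / 2)) * cis ((2 * t - n)\<^sup>2 * (A2 / B2) / 2 + (2 * t - n) / B1))"
        unfolding w_def \<eta>_def exp_half_i cis_mult by (simp only:)
      have reorder: "w t * (d n * u * v * z) = (w t * z) * (d n * u * v)" for u v z
        by (simp only: mult_ac)
      show ?thesis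
        unfolding reorder e y_def chirp_dilate_def strip_def by simp
    qed
    moreover have "w t * \<psi> (0 + 1 * t) = chirp_translate a (strip \<psi>) 0 t" for t
      unfolding w_def chirp_translate_def strip_def cis_mult[of "- (a * t\<^sup>2 / 2)", symmetric]
      by simp
    ultimately show "l2_has_sum lborel (\<lambda>n t. y n * chirp_dilate a (strip \<phi>) n t)
        (chirp_translate a (strip \<psi>) 0)"
      by (simp only:)
  qed
  have \<Lambda>: "is_symbol B2 x \<Lambda>" and \<Gamma>: "is_symbol B2 y \<Gamma>"
    using lcst_symbol_is_symbol[OF assms(11)] lcst_symbol_is_symbol[OF assms(12)]
    by (simp_all only: x_def[abs_def] y_def[abs_def] \<eta>_def a_def entries)
  have "cfun.subspace (l2_orth_complement lborel (V 0) (V 1))"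
    using V0 V1 by (intro subspace_orth_complement) (auto simp: l2_closed_subspace_def)
  moreover have "lcst_family M1 M2 \<psi> 0 = (\<lambda>n t. \<omega> n * chirp_translate a (strip \<psi>) n t)"
    by (intro ext family0)
  ultimately have "l2_orthonormal_basis lborel (l2_orth_complement lborel (V 0) (V 1))
      (lcst_family M1 M2 \<psi> 0)
      \<longleftrightarrow> l2_orthonormal_basis lborel (l2_orth_complement lborel (V 0) (V 1))
          (chirp_translate a (strip \<psi>))"
    by (simp add: orthonormal_basis_unimodular_iff \<omega>_def)
  also have "\<dots> \<longleftrightarrow> (AE v in lborel. fold_product B2 \<Lambda> \<Lambda> v = 1 \<and> fold_product B2 \<Lambda> \<Gamma> v
      = 0 \<and> fold_product B2 \<Gamma> \<Gamma> v = 1)"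
    using assms(4) by (intro wavelet_basis_iff_symbol[OF _ V0 V1 V01 f_basis E_basis f g \<Lambda> \<Gamma>])
        (simp add: B2_def)
  also have "\<dots> \<longleftrightarrow> (AE u in lborel. lcst_U M1 M2 \<Lambda> \<Gamma> u ** conj_transpose (lcst_U M1 M2 \<Lambda> \<Gamma> u)
      = mat 1)"
    using lcst_U_unitary_iff[OF assms(2,4), of \<Lambda> \<Gamma>] by (simp add: B2_def)
  finally show ?thesis .
qed

end
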